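(* Let $d\ge 1$ be an integer and $\beta \in (0,d]$. For $\mu \in DS_\beta(\mathbb{R}^d)$ one has $$\dim_{\mathcal{H}} \mu \geq \beta.$$
   Context: $M_b(\mathbb{R}^d)$ is the space of finite (signed) Radon measures on $\mathbb{R}^d$; $|\mu|$ denotes the total variation measure. $e^{t\Delta}\mu(x)=\int_{\mathbb{R}^d}(4\pi t)^{-d/2}e^{-|x-y|^2/4t}\,d\mu(y)$ is the heat semigroup. $\beta$-atom ($\beta\in(0,d]$): a measure $a\in M_b(\mathbb{R}^d)$ for which there is a cube $Q\subset\mathbb{R}^d$ with sides parallel to the coordinate axes, of side length $l(Q)$, such that (1) $\operatorname{supp} a\subset Q$; (2) $a(Q)=0$; (3) $\sup_{x\in\mathbb{R}^d,\,t>0}|t^{(d-\beta)/2}e^{t\Delta}a(x)|\le l(Q)^{-\beta}$; (4) $|a|(\mathbb{R}^d)\le 1$. $DS_\beta(\mathbb{R}^d)$ is the set of $\mu\in M_b(\mathbb{R}^d)$ for which there are scalars $\lambda_{i,n}$ and $\beta$-atoms $a_{i,n}$ ($1\le i\le n$, $n\in\mathbb{N}$) with $\limsup_{n\to\infty}\sum_{i=1}^n|\lambda_{i,n}|<+\infty$ and $\mu=\lim_{n\to\infty}\sum_{i=1}^n\lambda_{i,n}a_{i,n}$ weakly-star as measures, i.e. $\int\varphi\,d\mu=\lim_{n\to\infty}\sum_{i=1}^n\lambda_{i,n}\int\varphi\,da_{i,n}$ for all $\varphi\in C_0(\mathbb{R}^d)$. Lower Hausdorff dimension of a measure: $\dim_{\mathcal{H}}\mu=\sup\{\beta\in(0,d]: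 \mathcal{H}^\beta(E)=0 \implies |\mu|(E)=0\}$ (the implication being required for all Borel sets $E$), where $\mathcal{H}^\beta$ is Hausdorff measure. *)

theory Defs
  imports "HOL-Analysis.Analysis"
begin

(* A finite signed Radon measure is rendered as a real-valued, countably additive function on the
   Borel sets (on R^d every such function is automatically Radon). Values of mu on non-Borel sets
   are irrelevant. *)

definition finite_signed_measure :: "('a::topological_space set \<Rightarrow> real) \<Rightarrow> bool" where
  "finite_signed_measure mu \<longleftrightarrow>
     mu {} = 0 \<and>
     (\<forall>A. range A \<subseteq> sets borel \<longrightarrow> disjoint_family A \<longrightarrow>
        (\<lambda>n::nat. mu (A n)) sums mu (\<Union>n. A n))"

(* Jordan decomposition: mu^+(A) = sup {mu(B) : B a Borel subset of A} and mu^- = (-mu)^+.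
   The coercion ennreal sends negative reals to 0, which does not affect the supremum
   since B = {} is allowed. *)

definition upper_variation :: "('a::topological_space set \<Rightarrow> real) \<Rightarrow> 'a measure" where
  "upper_variation mu =
     measure_of UNIV (sets borel) (\<lambda>A. SUP B\<in>{B\<in>sets borel. B \<subseteq> A}. ennreal (mu B))"

definition lower_variation :: "('a::topological_space set \<Rightarrow> real) \<Rightarrow> 'a measure" where
  "lower_variation mu = upper_variation (\<lambda>A. - mu A)"

definition total_variation :: "('a::topological_space set \<Rightarrow> real) \<Rightarrow> 'a measure" where
  "total_variation mu = measure_of UNIV (sets borel)
     (\<lambda>A. emeasure (upper_variation mu) A + emeasure (lower_variation mu) A)"

lemma space_variation [simp]:
  "space (upper_variation mu) = UNIV"
  "space (lower_variation mu) = UNIV"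
  "space (total_variation mu) = UNIV"
  by (simp_all add: upper_variation_def lower_variation_def total_variation_def
        space_measure_of_conv)

lemma sets_variation [simp, measurable_cong]:
  "sets (upper_variation mu) = sets borel"
  "sets (lower_variation mu) = sets borel"
  "sets (total_variation mu) = sets borel"
  by (simp_all add: upper_variation_def lower_variation_def total_variation_def
        sets.sigma_sets_eq[of borel, simplified])

lemma finite_signed_measure_Un:
  assumes mu: "finite_signed_measure mu" and A: "A \<in> sets borel" and B: "B \<in> sets borel"
    and disj: "A \<inter> B = {}"
  shows "mu (A \<union> B) = mu A + mu B"
proof -
  have r: "range (binaryset A B) \<subseteq> sets borel"
    using A B by (simp add: range_binaryset_eq)
  have "disjoint_family (binaryset A B)"
    using disj by (auto simp: disjoint_family_on_def binaryset_def)
  then have "(\<lambda>n. mu (binaryset A B n)) sums mu (\<Union>n. binaryset A B n)"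
    using mu r unfolding finite_signed_measure_def by blast
  moreover have "(\<lambda>n. mu (binaryset A B n)) sums (mu A + mu B)"
    using mu by (intro binaryset_sums) (simp add: finite_signed_measure_def)
  ultimately show ?thesis
    by (simp add: UN_binaryset_eq sums_iff)
qed

lemma finite_signed_measure_uminus:
  "finite_signed_measure mu \<Longrightarrow> finite_signed_measure (\<lambda>A. - mu A)"
  unfolding finite_signed_measure_def by (simp add: sums_minus)

(* The set function in upper_variation is countably additive, so measure_of keeps it. *)

lemma emeasure_upper_variation:
  assumes mu: "finite_signed_measure mu" and A: "A \<in> sets borel"
  shows "emeasure (upper_variation mu) A = (SUP B\<in>{B\<in>sets borel. B \<subseteq> A}. ennreal (mu B))"
proof -
  define \<nu> where "\<nu> A = (SUP B\<in>{B\<in>sets borel. B \<subseteq> A}. ennreal (mu B))" for A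
  have mu0: "mu {} = 0" using mu by (simp add: finite_signed_measure_def)
  have up: "ennreal (mu B) \<le> \<nu> C" if "B \<in> sets borel" "B \<subseteq> C" for B C
    unfolding \<nu>_def using that by (intro SUP_upper) auto
  have \<nu>0: "\<nu> {} = 0"
    unfolding \<nu>_def by (auto intro!: antisym SUP_least simp: mu0)
  have super: "\<nu> C + \<nu> D \<le> \<nu> (C \<union> D)" if CD: "C \<inter> D = {}" for C D
  proof -
    have one: "ennreal (mu B) + ennreal (mu B') \<le> \<nu> (C \<union> D)"
      if B: "B \<in> sets borel" "B \<subseteq> C" and B': "B' \<in> sets borel" "B' \<subseteq> D" for B B'
    proof (cases "mu B \<le> 0 \<or> mu B' \<le> 0")
      case True
      moreover have "ennreal (mu B) \<le> \<nu> (C \<union> D)" "ennreal (mu B') \<le> \<nu> (C \<union> D)"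
        using B B' by (blast intro: up)+
      ultimately show ?thesis
        by (auto simp: ennreal_neg)
    next
      case False
      have "mu (B \<union> B') = mu B + mu B'"
        using B B' CD by (intro finite_signed_measure_Un[OF mu]) auto
      moreover have "ennreal (mu (B \<union> B')) \<le> \<nu> (C \<union> D)"
        using B B' by (intro up) auto
      ultimately show ?thesis
        using False by simp
    qed
    have "\<nu> C + \<nu> D =
        (SUP B\<in>{B\<in>sets borel. B \<subseteq> C}. SUP B'\<in>{B\<in>sets borel. B \<subseteq> D}. ennreal (mu B) + ennreal (mu B'))"
    proof -
      have ne: "{B\<in>sets borel. B \<subseteq> S} \<noteq> {}" for S :: "'a set" by blast
      show ?thesis
        unfolding \<nu>_def
        by (subst ennreal_SUP_add_left[symmetric], rule ne, rule SUP_cong, simp,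
            rule ennreal_SUP_add_right[OF ne])
    qed
    also have "\<dots> \<le> \<nu> (C \<union> D)"
      by (intro SUP_least one) auto
    finally show ?thesis .
  qed
  have fin: "(\<Sum>n<N. \<nu> (F n)) \<le> \<nu> (\<Union>n<N. F n)" if "disjoint_family F" for F :: "nat \<Rightarrow> 'a set" and N
  proof (induction N)
    case 0
    then show ?case by (simp add: \<nu>0)
  next
    case (Suc N)
    have "(\<Union>n<N. F n) \<inter> F N = {}"
    proof -
      have "F n \<inter> F N = {}" if "n < N" for n
        using that \<open>disjoint_family F\<close> by (intro disjoint_family_onD[of F UNIV]) auto
      then show ?thesis by blast
    qed
    then have "\<nu> (\<Union>n<N. F n) + \<nu> (F N) \<le> \<nu> ((\<Union>n<N. F n) \<union> F N)"
      by (rule super)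
    moreover have "(\<Union>n<N. F n) \<union> F N = (\<Union>n<Suc N. F n)"
      by (auto simp: lessThan_Suc)
    ultimately have "\<nu> (\<Union>n<N. F n) + \<nu> (F N) \<le> \<nu> (\<Union>n<Suc N. F n)"
      by simp
    with add_right_mono[OF Suc, of "\<nu> (F N)"] show ?case
      unfolding sum.lessThan_Suc by (rule order_trans)
  qed
  have "countably_additive (sets borel) \<nu>"
  proof (rule countably_additiveI)
    fix F :: "nat \<Rightarrow> 'a set"
    assume F: "range F \<subseteq> sets borel" "disjoint_family F" "\<Union> (range F) \<in> sets borel"
    show "(\<Sum>n. \<nu> (F n)) = \<nu> (\<Union> (range F))"
    proof (rule antisym)
      show "(\<Sum>n. \<nu> (F n)) \<le> \<nu> (\<Union> (range F))"
      proof (rule suminf_le_const)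
        fix N
        have "\<nu> (\<Union>n<N. F n) \<le> \<nu> (\<Union> (range F))"
          unfolding \<nu>_def by (intro SUP_subset_mono) auto
        with fin[OF F(2), of N] show "(\<Sum>n<N. \<nu> (F n)) \<le> \<nu> (\<Union> (range F))"
          by (rule order_trans)
      qed simp
      show "\<nu> (\<Union> (range F)) \<le> (\<Sum>n. \<nu> (F n))"
        unfolding \<nu>_def[of "\<Union> (range F)"]
      proof (rule SUP_least, clarify)
        fix B assume B: "B \<in> sets borel" "B \<subseteq> \<Union> (range F)"
        have "range (\<lambda>n. B \<inter> F n) \<subseteq> sets borel" "disjoint_family (\<lambda>n. B \<inter> F n)"
          using F B by (auto simp: disjoint_family_on_def)
        then have "(\<lambda>n. mu (B \<inter> F n)) sums mu (\<Union>n. B \<inter> F n)"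
          using mu unfolding finite_signed_measure_def by blast
        moreover have "(\<Union>n. B \<inter> F n) = B" using B by auto
        ultimately have lim: "(\<lambda>N. \<Sum>n<N. mu (B \<inter> F n)) \<longlonglongrightarrow> mu B"
          by (simp add: sums_def)
        have "ennreal (\<Sum>n<N. mu (B \<inter> F n)) \<le> (\<Sum>n. \<nu> (F n))" for N
        proof -
          have "ennreal (\<Sum>n<N. mu (B \<inter> F n)) \<le> ennreal (\<Sum>n<N. max 0 (mu (B \<inter> F n)))"
            by (intro ennreal_leI sum_mono) auto
          also have "\<dots> = (\<Sum>n<N. ennreal (max 0 (mu (B \<inter> F n))))"
            by (intro sum_ennreal[symmetric]) auto
          also have "\<dots> \<le> (\<Sum>n<N. \<nu> (F n))"
            using F B by (intro sum_mono) (auto intro!: up simp: max_def)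
          also have "\<dots> \<le> (\<Sum>n. \<nu> (F n))"
            by (intro sum_le_suminf) auto
          finally show ?thesis .
        qed
        then show "ennreal (mu B) \<le> (\<Sum>n. \<nu> (F n))"
          using lim by (intro LIMSEQ_le_const2[OF tendsto_ennrealI]) auto
      qed
    qed
  qed
  moreover have "positive (sets borel) \<nu>"
    by (simp add: positive_def \<nu>0)
  moreover have "sigma_algebra (UNIV :: 'a set) (sets borel)"
    using sets.sigma_algebra_axioms[of "borel :: 'a measure"] by simp
  ultimately show ?thesis
    unfolding upper_variation_def \<nu>_def[symmetric]
    by (intro emeasure_measure_of_sigma A)
qed

lemma emeasure_lower_variation:
  assumes "finite_signed_measure mu" "A \<in> sets borel"
  shows "emeasure (lower_variation mu) A = (SUP B\<in>{B\<in>sets borel. B \<subseteq> A}. ennreal (- mu B))"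
  unfolding lower_variation_def
  by (rule emeasure_upper_variation[OF finite_signed_measure_uminus]) (fact assms)+

lemma emeasure_total_variation:
  assumes A: "A \<in> sets borel"
  shows "emeasure (total_variation mu) A =
    emeasure (upper_variation mu) A + emeasure (lower_variation mu) A"
proof -
  let ?f = "\<lambda>A. emeasure (upper_variation mu) A + emeasure (lower_variation mu) A"
  have "countably_additive (sets borel) ?f"
  proof (rule countably_additiveI)
    fix F :: "nat \<Rightarrow> 'a set"
    assume F: "range F \<subseteq> sets borel" "disjoint_family F"
    show "(\<Sum>n. ?f (F n)) = ?f (\<Union> (range F))"
      using F by (subst suminf_add[symmetric]) (simp_all add: suminf_emeasure)
  qed
  moreover have "positive (sets borel) ?f" by (simp add: positive_def)
  moreover have "sigma_algebra (UNIV :: 'a set) (sets borel)"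
    using sets.sigma_algebra_axioms[of "borel :: 'a measure"] by simp
  ultimately show ?thesis
    unfolding total_variation_def by (intro emeasure_measure_of_sigma A)
qed

definition signed_integral :: "('a::topological_space set \<Rightarrow> real) \<Rightarrow> ('a \<Rightarrow> real) \<Rightarrow> real" where
  "signed_integral mu f =
     (LINT x|upper_variation mu. f x) - (LINT x|lower_variation mu. f x)"

definition signed_support :: "('a::topological_space set \<Rightarrow> real) \<Rightarrow> 'a set" where
  "signed_support mu =
     {x. \<forall>U. open U \<longrightarrow> x \<in> U \<longrightarrow> emeasure (total_variation mu) U > 0}"

definition heat_semigroup ::
    "real \<Rightarrow> ((real ^ 'n) set \<Rightarrow> real) \<Rightarrow> real ^ 'n \<Rightarrow> real" where
  "heat_semigroup t mu x = signed_integral mu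
     (\<lambda>y. (4 * pi * t) powr (- (real CARD('n) / 2)) * exp (- ((norm (x - y))\<^sup>2 / (4 * t))))"

(* The cube is the closed cube with corner c and side length l; closedness is harmless, as the
   support of a is closed. *)

definition beta_atom :: "real \<Rightarrow> ((real ^ 'n) set \<Rightarrow> real) \<Rightarrow> bool" where
  "beta_atom \<beta> a \<longleftrightarrow>
     finite_signed_measure a \<and>
     (\<exists>c l. l > 0 \<and>
        (let Q = cbox c (c + (\<chi> i. l)) in
           signed_support a \<subseteq> Q \<and>
           a Q = 0 \<and>
           (\<forall>x t. t > 0 \<longrightarrow>
              \<bar>t powr ((real CARD('n) - \<beta>) / 2) * heat_semigroup t a x\<bar> \<le> l powr (- \<beta>)) \<and>
           emeasure (total_variation a) UNIV \<le> 1))"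

definition C0_functions :: "('a::real_normed_vector \<Rightarrow> real) set" where
  "C0_functions = {\<phi>. continuous_on UNIV \<phi> \<and> (\<phi> \<longlongrightarrow> 0) at_infinity}"

definition DS :: "real \<Rightarrow> ((real ^ 'n) set \<Rightarrow> real) set" where
  "DS \<beta> = {mu. finite_signed_measure mu \<and>
     (\<exists>(c :: nat \<Rightarrow> nat \<Rightarrow> real) (a :: nat \<Rightarrow> nat \<Rightarrow> (real ^ 'n) set \<Rightarrow> real).
        (\<forall>n. \<forall>i\<in>{1..n}. beta_atom \<beta> (a i n)) \<and>
        limsup (\<lambda>n. ereal (\<Sum>i=1..n. \<bar>c i n\<bar>)) < \<infinity> \<and>
        (\<forall>\<phi>\<in>C0_functions.
           (\<lambda>n. \<Sum>i=1..n. c i n * signed_integral (a i n) \<phi>)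
             \<longlonglongrightarrow> signed_integral mu \<phi>))}"

(* Hausdorff measure with the normalisation diam^s (no dimensional constant), for s > 0.
   Covering sets are required to be bounded because diameter is only meaningful for those. *)

definition hausdorff_premeasure :: "real \<Rightarrow> real \<Rightarrow> 'a::metric_space set \<Rightarrow> ennreal" where
  "hausdorff_premeasure s \<delta> E =
     (INF U\<in>{U :: nat \<Rightarrow> 'a set. (\<forall>i. bounded (U i) \<and> diameter (U i) \<le> \<delta>) \<and> E \<subseteq> (\<Union>i. U i)}.
        \<Sum>i. ennreal (diameter (U i) powr s))"

definition hausdorff_measure :: "real \<Rightarrow> 'a::metric_space set \<Rightarrow> ennreal" where
  "hausdorff_measure s E = (SUP \<delta>\<in>{0<..}. hausdorff_premeasure s \<delta> E)"

(* Taken in ennreal so that the supremum of the empty set is 0. *)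

definition lower_hausdorff_dim :: "((real ^ 'n) set \<Rightarrow> real) \<Rightarrow> ennreal" where
  "lower_hausdorff_dim mu =
     (SUP \<beta>\<in>{\<beta>. 0 < \<beta> \<and> \<beta> \<le> real CARD('n) \<and>
         (\<forall>E\<in>sets borel. hausdorff_measure \<beta> E = 0 \<longrightarrow> emeasure (total_variation mu) E = 0)}.
        ennreal \<beta>)"

end

theory Submission
  imports Defs
begin

text \<open>
  Since the lower dimension is a supremum, it is enough to treat exponents \<open>\<alpha> < \<beta>\<close> close to \<open>\<beta>\<close>, and to
  show that the variation of a measure \<open>mu\<close> in \<open>DS \<beta>\<close> vanishes on each Borel set of \<open>\<alpha>\<close>-dimensional
  Hausdorff measure zero. Suppose it does not. Then, up to a sign, there is a compact set \<open>K\<close> of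
  \<open>\<alpha>\<close>-dimensional Hausdorff measure zero on which \<open>mu\<close> has positive mass and almost no negative part
  (\<open>compact_where_positive_part_dominates\<close>).

  The test functions are sums of Gaussians. The integral of a Gaussian of width \<open>r\<close> against a
  \<open>\<beta>\<close>-atom \<open>a\<close> is, up to normalisation, a value of the heat extension of \<open>a\<close> at time \<open>r\<^sup>2\<close>, so the
  size condition on atoms bounds it by a constant times \<open>(r / l) powr \<beta>\<close>, where \<open>l\<close> is the side of the
  cube of \<open>a\<close>. A sum of Gaussians is therefore invisible for atoms on cubes that are large compared
  with its cost \<open>\<Sum>r powr \<beta>\<close>; because atoms have mean zero, it is also invisible for atoms on very
  small cubes (\<open>beta_atom_estimates\<close>). Atoms at intermediate scales do respond, but the response is
  at most the supremum of the sum.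

  The geometric core is \<open>gaussian_potential_of_null_set\<close>: there are sums of Gaussians centred on
  \<open>K\<close>, of arbitrarily small cost, that are bounded below on \<open>K\<close> and bounded above everywhere by a
  constant \<open>B\<close> independent of the cost. They come from covers of \<open>K\<close> with small total
  \<open>\<alpha>\<close>-dimensional size, after rounding the radii up to a sparse sequence of scales, for which the
  gap between \<open>\<alpha>\<close> and \<open>\<beta>\<close> leaves room, and omitting the Gaussians at points where those of larger
  scales already suffice (\<open>multiscale_gaussian_cover\<close>).

  Now choose a sequence of such sums inductively so that their ranges of intermediate scales are
  disjoint. Each atom responds to at most one of them, up to a summable error, so the sum of any
  number of them has integral at most \<open>B + 2\<close> in modulus against every atom
  (\<open>asymptotically_invisible_potentials\<close>), and by duality a bounded integral against \<open>mu\<close>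
  (\<open>DS_pairing_bound\<close>). But as the cost tends to zero the sums converge to zero off \<open>K\<close>, so the
  integral of each late one against \<open>mu\<close> exceeds a fixed \<open>\<kappa> > 0\<close>
  (\<open>eventually_signed_integral_ge\<close>), and the integral of \<open>N\<close> of them exceeds \<open>N * \<kappa>\<close>. This is a
  contradiction for large \<open>N\<close>.
\<close>

section \<open>Jordan decomposition of finite signed measures\<close>

lemma finite_signed_measure_Diff:
  assumes mu: "finite_signed_measure mu" and "A \<in> sets borel" "B \<in> sets borel" "B \<subseteq> A"
  shows "mu (A - B) = mu A - mu B"
proof -
  have "mu (B \<union> (A - B)) = mu B + mu (A - B)"
    using assms by (intro finite_signed_measure_Un[OF mu]) auto
  moreover have "B \<union> (A - B) = A" using assms by auto
  ultimately show ?thesis by simp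
qed

text \<open>
  If \<open>A\<close> has Borel subsets of arbitrarily large measure, it splits into two pieces of measure at
  least \<open>1\<close> in modulus, and one of the two pieces again has subsets of arbitrarily large measure.
  Iterating produces infinitely many disjoint sets of measure at least \<open>1\<close> in modulus, whose
  measures cannot form a convergent series.
\<close>

lemma finite_signed_measure_bounded:
  fixes mu :: "'a::topological_space set \<Rightarrow> real"
  assumes mu: "finite_signed_measure mu"
  shows "\<exists>C. \<forall>B\<in>sets borel. \<bar>mu B\<bar> \<le> C"
proof (rule ccontr)
  assume contr: "\<not> ?thesis"
  define unb where
    "unb A \<longleftrightarrow> A \<in> sets borel \<and> (\<forall>C. \<exists>B\<in>sets borel. B \<subseteq> A \<and> \<bar>mu B\<bar> > C)" for A :: "'a set"
  have unb_UNIV: "unb UNIV"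
    using contr by (auto simp: unb_def not_le)
  have step: "\<exists>B. unb B \<and> B \<subseteq> A \<and> \<bar>mu (A - B)\<bar> \<ge> 1" if A: "unb A" for A
  proof -
    have Ab: "A \<in> sets borel" using A by (simp add: unb_def)
    obtain B where B: "B \<in> sets borel" "B \<subseteq> A" "\<bar>mu B\<bar> > \<bar>mu A\<bar> + 1"
      using A unfolding unb_def by blast
    have diff: "mu (A - B) = mu A - mu B"
      using finite_signed_measure_Diff[OF mu Ab] B by auto
    have "unb B \<or> unb (A - B)"
    proof (rule ccontr)
      assume "\<not> (unb B \<or> unb (A - B))"
      then have "\<not> unb B" "\<not> unb (A - B)" by simp_all
      then obtain C1 C2 where C: "\<And>D. D \<in> sets borel \<Longrightarrow> D \<subseteq> B \<Longrightarrow> \<bar>mu D\<bar> \<le> C1"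
        "\<And>D. D \<in> sets borel \<Longrightarrow> D \<subseteq> A - B \<Longrightarrow> \<bar>mu D\<bar> \<le> C2"
        using Ab B(1) unfolding unb_def by (meson not_less sets.Diff)
      obtain D where D: "D \<in> sets borel" "D \<subseteq> A" "\<bar>mu D\<bar> > C1 + C2"
        using A unfolding unb_def by blast
      have "mu ((D \<inter> B) \<union> (D - B)) = mu (D \<inter> B) + mu (D - B)"
        using D B by (intro finite_signed_measure_Un[OF mu]) auto
      moreover have "(D \<inter> B) \<union> (D - B) = D" by auto
      moreover have "\<bar>mu (D \<inter> B)\<bar> \<le> C1" "\<bar>mu (D - B)\<bar> \<le> C2"
        using D B by (auto intro!: C)
      ultimately show False using D(3) by simp
    qed
    then show ?thesis
    proof
      assume "unb B"
      then show ?thesis using B diff by (intro exI[of _ B]) auto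
    next
      assume "unb (A - B)"
      moreover have "A - (A - B) = B" using B by auto
      ultimately show ?thesis using B by (intro exI[of _ "A - B"]) auto
    qed
  qed
  have "\<exists>f. \<forall>n. unb (f n) \<and> f (Suc n) \<subseteq> f n \<and> \<bar>mu (f n - f (Suc n))\<bar> \<ge> 1"
    by (rule dependent_nat_choice) (use unb_UNIV step in blast)+
  then obtain f where f: "\<And>n. unb (f n)" "\<And>n. f (Suc n) \<subseteq> f n \<and> \<bar>mu (f n - f (Suc n))\<bar> \<ge> 1"
    by blast
  define D where "D n = f n - f (Suc n)" for n
  have anti: "f n \<subseteq> f m" if "m \<le> n" for m n
    using that f(2) by (rule_tac lift_Suc_antimono_le[of f]) auto
  have "D m \<inter> D n = {}" if "m < n" for m n
    using anti[of "Suc m" n] that by (auto simp: D_def)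
  then have "disjoint_family D"
    unfolding disjoint_family_on_def by (metis Int_commute linorder_neqE_nat)
  moreover have "range D \<subseteq> sets borel"
    using f(1) by (auto simp: D_def unb_def)
  ultimately have "(\<lambda>n. mu (D n)) sums mu (\<Union>n. D n)"
    using mu unfolding finite_signed_measure_def by blast
  then have "(\<lambda>n. mu (D n)) \<longlonglongrightarrow> 0"
    by (intro summable_LIMSEQ_zero) (simp add: sums_iff)
  then have "eventually (\<lambda>n. \<bar>mu (D n)\<bar> < 1) sequentially"
    by (auto dest!: tendstoD[where e=1])
  then obtain n where "\<bar>mu (D n)\<bar> < 1"
    by (auto simp: eventually_sequentially)
  then show False using f(2)[of n] by (simp add: D_def)
qed

lemma finite_measure_upper_variation:
  assumes mu: "finite_signed_measure mu"
  shows "finite_measure (upper_variation mu)"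
proof -
  obtain C where C: "\<And>B. B \<in> sets borel \<Longrightarrow> \<bar>mu B\<bar> \<le> C"
    using finite_signed_measure_bounded[OF mu] by blast
  have "emeasure (upper_variation mu) UNIV \<le> ennreal C"
    by (subst emeasure_upper_variation[OF mu], simp, intro SUP_least ennreal_leI) (use C in force)
  then show ?thesis
    by (intro finite_measureI) (auto simp: top_unique)
qed

lemma finite_measure_lower_variation:
  "finite_signed_measure mu \<Longrightarrow> finite_measure (lower_variation mu)"
  unfolding lower_variation_def
  by (intro finite_measure_upper_variation finite_signed_measure_uminus)

lemma signed_measure_le_upper:
  assumes mu: "finite_signed_measure mu" and B: "B \<in> sets borel" "B \<subseteq> A" "A \<in> sets borel"
  shows "mu B \<le> measure (upper_variation mu) A"
proof -
  interpret finite_measure "upper_variation mu"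
    by (rule finite_measure_upper_variation[OF mu])
  have "ennreal (mu B) \<le> emeasure (upper_variation mu) A"
    unfolding emeasure_upper_variation[OF mu B(3)] using B by (intro SUP_upper) auto
  then show ?thesis
    by (simp add: emeasure_eq_measure ennreal_le_iff)
qed

lemma upper_variation_least:
  assumes mu: "finite_signed_measure mu" and A: "A \<in> sets borel"
    and le: "\<And>B. B \<in> sets borel \<Longrightarrow> B \<subseteq> A \<Longrightarrow> mu B \<le> C"
  shows "measure (upper_variation mu) A \<le> C"
proof -
  interpret finite_measure "upper_variation mu"
    by (rule finite_measure_upper_variation[OF mu])
  have C: "0 \<le> C" using le[of "{}"] mu by (simp add: finite_signed_measure_def)
  have "emeasure (upper_variation mu) A \<le> ennreal C"
    unfolding emeasure_upper_variation[OF mu A] using le by (intro SUP_least ennreal_leI) auto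
  then show ?thesis
    using C by (simp add: emeasure_eq_measure)
qed

text \<open>
  For \<open>B \<subseteq> A\<close> one has \<open>mu B = mu A - mu (A - B)\<close>; the supremum of the left-hand side over \<open>B\<close>
  is the upper variation, that of \<open>- mu (A - B)\<close> is the lower variation. Finiteness allows the
  subtraction.
\<close>

lemma signed_measure_Jordan:
  assumes mu: "finite_signed_measure mu" and A: "A \<in> sets borel"
  shows "mu A = measure (upper_variation mu) A - measure (lower_variation mu) A"
proof -
  note mu' = finite_signed_measure_uminus[OF mu]
  have diff: "mu (A - B) = mu A - mu B" if "B \<in> sets borel" "B \<subseteq> A" for B
    using finite_signed_measure_Diff[OF mu A] that by auto
  have "measure (upper_variation mu) A \<le> mu A + measure (lower_variation mu) A"
  proof (rule upper_variation_least[OF mu A])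
    fix B assume B: "B \<in> sets borel" "B \<subseteq> A"
    have "- mu (A - B) \<le> measure (lower_variation mu) A"
      unfolding lower_variation_def using signed_measure_le_upper[OF mu', of "A - B" A] A B by auto
    then show "mu B \<le> mu A + measure (lower_variation mu) A"
      using diff[OF B] by simp
  qed
  moreover have "measure (lower_variation mu) A \<le> measure (upper_variation mu) A - mu A"
    unfolding lower_variation_def
  proof (rule upper_variation_least[OF mu' A])
    fix B assume B: "B \<in> sets borel" "B \<subseteq> A"
    have "mu (A - B) \<le> measure (upper_variation mu) A"
      using signed_measure_le_upper[OF mu, of "A - B" A] A B by auto
    then show "- mu B \<le> measure (upper_variation mu) A - mu A"
      using diff[OF B] by simp
  qed
  ultimately show ?thesis by simp
qed

lemma lower_variation_uminus:
  "upper_variation (\<lambda>A. - mu A) = lower_variation mu"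
  "lower_variation (\<lambda>A. - mu A) = upper_variation mu"
  by (simp_all add: lower_variation_def)

lemma signed_integral_uminus: "signed_integral (\<lambda>A. - mu A) f = - signed_integral mu f"
  by (simp add: signed_integral_def lower_variation_uminus)

lemma integrable_bounded_continuous:
  fixes f :: "'a::topological_space \<Rightarrow> real"
  assumes "finite_measure M" and s: "sets M = sets borel"
    and f: "continuous_on UNIV f" "\<And>x. \<bar>f x\<bar> \<le> C"
  shows "integrable M f"
proof -
  interpret finite_measure M by fact
  have "f \<in> borel_measurable M"
    using borel_measurable_continuous_onI[OF f(1)] s by (simp cong: measurable_cong_sets)
  then show ?thesis
    using f(2) by (intro integrable_const_bound[of _ C]) auto
qed

lemma signed_integral_sum:
  fixes f :: "'i \<Rightarrow> 'a::topological_space \<Rightarrow> real"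
  assumes mu: "finite_signed_measure mu"
    and f: "\<And>i. i \<in> I \<Longrightarrow> continuous_on UNIV (f i)" "\<And>i x. i \<in> I \<Longrightarrow> \<bar>f i x\<bar> \<le> C i"
  shows "signed_integral mu (\<lambda>x. \<Sum>i\<in>I. f i x) = (\<Sum>i\<in>I. signed_integral mu (f i))"
proof -
  have "integrable (upper_variation mu) (f i)" "integrable (lower_variation mu) (f i)" if "i \<in> I" for i
    using that f finite_measure_upper_variation[OF mu] finite_measure_lower_variation[OF mu]
    by (auto intro!: integrable_bounded_continuous[of _ "f i" "C i"])
  then show ?thesis
    unfolding signed_integral_def by (simp add: Bochner_Integration.integral_sum sum_subtractf)
qed

section \<open>Gaussians centred at separated points\<close>

text \<open>
  The balls of radius \<open>r / 2\<close> around the points of \<open>X\<close> are disjoint and lie in a ball of radius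
  \<open>(s + 1 / 2) * r\<close>; compare volumes.
\<close>

lemma separated_card_le:
  fixes X :: "'a::euclidean_space set"
  assumes X: "finite X" "pairwise (\<lambda>p q. r \<le> dist p q) X" and r: "0 < r"
    and near: "\<And>p. p \<in> X \<Longrightarrow> dist x p \<le> s * r" and s: "0 \<le> s"
  shows "real (card X) \<le> (2 * s + 1) ^ DIM('a)"
proof -
  define u where "u = measure lborel (ball (0 :: 'a) 1)"
  have u: "0 < u" unfolding u_def by (rule content_ball_pos) simp
  have vol: "measure lborel (ball c t) = t ^ DIM('a) * u" if "0 \<le> t" for c :: 'a and t
    unfolding u_def by (rule content_ball_conv_unit_ball[OF that])
  have disj: "disjoint_family_on (\<lambda>p. ball p (r / 2)) X"
    unfolding disjoint_family_on_def
  proof (intro ballI impI)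
    fix p q assume pq: "p \<in> X" "q \<in> X" "p \<noteq> q"
    then have "r \<le> dist p q" using X(2) by (auto simp: pairwise_def)
    then show "ball p (r / 2) \<inter> ball q (r / 2) = {}"
      by (intro disjoint_ballI) simp
  qed
  have "card X * ((r / 2) ^ DIM('a) * u) = (\<Sum>p\<in>X. measure lborel (ball p (r / 2)))"
    using r by (simp add: vol)
  also have "\<dots> = measure lborel (\<Union>p\<in>X. ball p (r / 2))"
    using X(1) disj
    by (intro measure_finite_Union[symmetric]) (auto simp: order.strict_implies_not_eq[OF emeasure_lborel_ball_finite, simplified])
  also have "\<dots> \<le> measure lborel (ball x ((s + 1 / 2) * r))"
  proof (rule measure_mono_fmeasurable)
    show "(\<Union>p\<in>X. ball p (r / 2)) \<subseteq> ball x ((s + 1 / 2) * r)"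
    proof (clarsimp)
      fix p y assume p: "p \<in> X" and y: "dist p y * 2 < r"
      have "dist x y \<le> dist x p + dist p y" by (rule dist_triangle)
      with near[OF p] y show "dist x y < (s + 1 / 2) * r"
        by (simp add: algebra_simps)
    qed
  qed (auto simp: X(1) intro!: fmeasurableI emeasure_lborel_ball_finite[simplified])
  also have "\<dots> = ((s + 1 / 2) * r) ^ DIM('a) * u"
    using r s by (simp add: vol)
  also have "\<dots> = (2 * s + 1) ^ DIM('a) * ((r / 2) ^ DIM('a) * u)"
    by (simp add: power_mult_distrib[symmetric] field_simps)
  finally show ?thesis
    using r u by simp
qed

text \<open>
  Sort the points into shells \<open>m \<le> norm (p - x) / r < m + 1\<close>. The number of points in a shell grows
  like a power of \<open>m\<close>, so the Gaussian weights make the sum over the shells converge, with a bound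
  that depends on the dimension only.
\<close>

lemma separated_gaussian_sum_bounded:
  "\<exists>C\<ge>1. \<forall>(X :: 'a::euclidean_space set) r x.
     finite X \<longrightarrow> pairwise (\<lambda>p q. r \<le> dist p q) X \<longrightarrow> 0 < r \<longrightarrow>
     (\<Sum>p\<in>X. exp (- ((norm (p - x) / r)\<^sup>2 / 8))) \<le> C"
proof -
  define d where "d = DIM('a)"
  define K :: real where "K = 4 ^ d * fact d * exp (3 / 4) * exp 2"
  define g :: "nat \<Rightarrow> real" where "g m = K * exp (- 1 / 2) ^ m" for m
  have K: "0 < K" by (simp add: K_def)
  have g_summable: "summable g"
    unfolding g_def by (intro summable_mult summable_geometric) simp
  have shell: "(2 * real (Suc m) + 1) ^ d * exp (2 - real m) \<le> g m" for m
  proof -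
    define y where "y = (2 * real (Suc m) + 1) / 4"
    have y: "0 \<le> y" and y4: "2 * real (Suc m) + 1 = 4 * y" by (simp_all add: y_def)
    \<comment> \<open>a single term of the exponential series turns the power \<open>d\<close> into an exponential\<close>
    have "y ^ d / fact d \<le> exp y"
    proof -
      have "(\<Sum>n\<in>{d}. inverse (fact n) *\<^sub>R y ^ n) \<le> (\<Sum>n. inverse (fact n) *\<^sub>R y ^ n)"
        using y by (intro sum_le_suminf summable_exp_generic) auto
      then show ?thesis by (simp add: exp_def field_simps)
    qed
    then have "(4 * y) ^ d \<le> 4 ^ d * (fact d * exp y)"
      by (simp add: power_mult_distrib field_simps)
    then have "(2 * real (Suc m) + 1) ^ d * exp (2 - real m)
        \<le> 4 ^ d * (fact d * exp y) * exp (2 - real m)"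
      unfolding y4 by (intro mult_right_mono) simp_all
    also have "\<dots> = 4 ^ d * fact d * (exp y * exp (2 - real m))"
      by (simp only: mult.assoc)
    also have "exp y * exp (2 - real m) = exp (3 / 4) * exp 2 * exp (real m * (- 1 / 2))"
      unfolding exp_add[symmetric] by (simp add: y_def field_simps)
    also have "exp (real m * (- 1 / 2)) = exp (- 1 / 2) ^ m"
      by (rule exp_of_nat_mult)
    also have "4 ^ d * fact d * (exp (3 / 4) * exp 2 * exp (- 1 / 2) ^ m) = g m"
      by (simp only: g_def K_def mult.assoc)
    finally show ?thesis .
  qed
  show ?thesis
  proof (intro exI[of _ "max 1 (suminf g)"] conjI allI impI)
    fix X :: "'a set" and r :: real and x :: 'a
    assume X: "finite X" "pairwise (\<lambda>p q. r \<le> dist p q) X" and r: "0 < r"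
    define n where "n p = nat \<lfloor>norm (p - x) / r\<rfloor>" for p
    have n: "real (n p) \<le> norm (p - x) / r" "norm (p - x) / r \<le> real (Suc (n p))" for p
    proof -
      have "0 \<le> norm (p - x) / r" using r by simp
      then show "real (n p) \<le> norm (p - x) / r" "norm (p - x) / r \<le> real (Suc (n p))"
        unfolding n_def by linarith+
    qed
    have "exp (- ((norm (p - x) / r)\<^sup>2 / 8)) \<le> exp (2 - real (n p))" for p
    proof -
      define s where "s = norm (p - x) / r"
      \<comment> \<open>completing the square: \<open>s - 2 \<le> s\<^sup>2 / 8\<close>\<close>
      have "0 \<le> (s - 4)\<^sup>2" by simp
      then have "- (s\<^sup>2 / 8) \<le> 2 - s" by (simp add: power2_eq_square algebra_simps)
      then show ?thesis using n(1)[of p] by (simp add: s_def[symmetric])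
    qed
    then have "(\<Sum>p\<in>X. exp (- ((norm (p - x) / r)\<^sup>2 / 8))) \<le> (\<Sum>p\<in>X. exp (2 - real (n p)))"
      by (rule sum_mono)
    also have "\<dots> = (\<Sum>m\<in>n ` X. \<Sum>p\<in>{p\<in>X. n p = m}. exp (2 - real (n p)))"
      by (rule sum.image_gen[OF X(1)])
    also have "\<dots> = (\<Sum>m\<in>n ` X. real (card {p\<in>X. n p = m}) * exp (2 - real m))"
      by (intro sum.cong) auto
    also have "\<dots> \<le> (\<Sum>m\<in>n ` X. g m)"
    proof (rule sum_mono)
      fix m
      have "real (card {p\<in>X. n p = m}) \<le> (2 * real (Suc m) + 1) ^ d"
        unfolding d_def
      proof (rule separated_card_le[OF _ _ r])
        show "dist x p \<le> real (Suc m) * r" if "p \<in> {p\<in>X. n p = m}" for p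
          using n(2)[of p] r that by (simp add: dist_norm norm_minus_commute field_simps)
      qed (use X in \<open>auto intro: pairwise_subset\<close>)
      then have "real (card {p\<in>X. n p = m}) * exp (2 - real m)
          \<le> (2 * real (Suc m) + 1) ^ d * exp (2 - real m)"
        by (rule mult_right_mono) simp
      also note shell
      finally show "real (card {p\<in>X. n p = m}) * exp (2 - real m) \<le> g m" .
    qed
    also have "\<dots> \<le> suminf g"
      using X(1) K by (intro sum_le_suminf g_summable) (auto simp: g_def)
    finally show "(\<Sum>p\<in>X. exp (- ((norm (p - x) / r)\<^sup>2 / 8))) \<le> max 1 (suminf g)" by simp
  qed simp
qed

definition gaussian :: "'a::real_normed_vector \<Rightarrow> real \<Rightarrow> 'a \<Rightarrow> real" where
  "gaussian p r x = exp (- ((norm (p - x))\<^sup>2 / (4 * r\<^sup>2)))"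

lemma gaussian_pos [simp]: "0 < gaussian p r x"
  and gaussian_nonneg [simp]: "0 \<le> gaussian p r x"
  and gaussian_le_1 [simp]: "gaussian p r x \<le> 1"
  by (simp_all add: gaussian_def)

lemma gaussian_eq: "gaussian p r x = exp (- ((norm (p - x) / r)\<^sup>2 / 4))"
  by (simp add: gaussian_def power_divide mult.commute)

text \<open>
  Mean value theorem; the linear factor of the derivative is absorbed by doubling the variance.
\<close>

lemma exp_neg_square_diff_le:
  fixes s t :: real
  assumes "0 \<le> s" "0 \<le> t"
  shows "\<bar>exp (- (s\<^sup>2 / 4)) - exp (- (t\<^sup>2 / 4))\<bar>
    \<le> \<bar>s - t\<bar> * (exp (- (s\<^sup>2 / 8)) + exp (- (t\<^sup>2 / 8)))"
proof -
  have *: "\<bar>exp (- (s\<^sup>2 / 4)) - exp (- (t\<^sup>2 / 4))\<bar>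
      \<le> \<bar>s - t\<bar> * (exp (- (s\<^sup>2 / 8)) + exp (- (t\<^sup>2 / 8)))"
    if st: "0 \<le> s" "s < t" for s t :: real
  proof -
    have "\<And>u. ((\<lambda>u. exp (- (u\<^sup>2 / 4))) has_real_derivative - (u / 2 * exp (- (u\<^sup>2 / 4)))) (at u)"
      by (auto intro!: derivative_eq_intros)
    then obtain u where u: "s < u" "u < t"
      "exp (- (t\<^sup>2 / 4)) - exp (- (s\<^sup>2 / 4)) = (t - s) * - (u / 2 * exp (- (u\<^sup>2 / 4)))"
      using MVT2[OF st(2), of "\<lambda>u. exp (- (u\<^sup>2 / 4))" "\<lambda>u. - (u / 2 * exp (- (u\<^sup>2 / 4)))"] by blast
    have "u / 2 \<le> 1 + u\<^sup>2 / 8"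
      using zero_le_power2[of "u - 2"] by (simp add: power2_eq_square algebra_simps)
    also have "\<dots> \<le> exp (u\<^sup>2 / 8)" by (rule exp_ge_add_one_self)
    finally have "u / 2 * exp (- (u\<^sup>2 / 4)) \<le> exp (u\<^sup>2 / 8) * exp (- (u\<^sup>2 / 4))"
      by (rule mult_right_mono) simp
    also have "\<dots> = exp (- (u\<^sup>2 / 8))" by (simp add: exp_add[symmetric])
    also have "\<dots> \<le> exp (- (s\<^sup>2 / 8))"
      using st u(1) by (simp add: power_mono)
    finally have le: "u / 2 * exp (- (u\<^sup>2 / 4)) \<le> exp (- (s\<^sup>2 / 8)) + exp (- (t\<^sup>2 / 8))"
      by (simp add: add_increasing2)
    have "\<bar>exp (- (s\<^sup>2 / 4)) - exp (- (t\<^sup>2 / 4))\<bar> = \<bar>s - t\<bar> * (u / 2 * exp (- (u\<^sup>2 / 4)))"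
      using u st by (subst abs_minus_commute) (simp add: abs_mult)
    also have "\<dots> \<le> \<bar>s - t\<bar> * (exp (- (s\<^sup>2 / 8)) + exp (- (t\<^sup>2 / 8)))"
      using le by (rule mult_left_mono) simp
    finally show ?thesis .
  qed
  consider "s < t" | "s = t" | "t < s" by linarith
  then show ?thesis
  proof cases
    case 3
    then show ?thesis using *[of t s] assms by (simp add: abs_minus_commute add.commute)
  qed (use * assms in auto)
qed

lemma gaussian_diff_le:
  fixes p :: "'a::real_normed_vector"
  assumes r: "0 < r"
  shows "\<bar>gaussian p r x - gaussian p r y\<bar>
    \<le> norm (x - y) / r * (exp (- ((norm (p - x) / r)\<^sup>2 / 8)) + exp (- ((norm (p - y) / r)\<^sup>2 / 8)))"
proof -
  have "\<bar>norm (p - x) - norm (p - y)\<bar> \<le> norm (x - y)"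
    using norm_triangle_ineq3[of "p - x" "p - y"] by (simp add: norm_minus_commute)
  then have "\<bar>norm (p - x) / r - norm (p - y) / r\<bar> \<le> norm (x - y) / r"
    using r by (simp add: diff_divide_distrib[symmetric] divide_right_mono)
  then show ?thesis
    unfolding gaussian_eq using r
    by (intro order_trans[OF exp_neg_square_diff_le mult_right_mono]) auto
qed

lemma gaussian_le_inverse_dist:
  fixes p :: "'a::real_normed_vector"
  assumes r: "0 < r" and D: "0 < D" "D \<le> norm (p - x)"
  shows "gaussian p r x \<le> 2 * r / D * exp (- ((norm (p - x) / r)\<^sup>2 / 8))"
proof -
  define s where "s = norm (p - x) / r"
  have sD: "D / r \<le> s" unfolding s_def using D r by (simp add: divide_right_mono)
  have s: "0 < s" using sD D r by (smt (verit) divide_pos_pos)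
  have "s / 2 \<le> 1 + s\<^sup>2 / 8"
    using zero_le_power2[of "s - 2"] by (simp add: power2_eq_square algebra_simps)
  also have "\<dots> \<le> exp (s\<^sup>2 / 8)" by (rule exp_ge_add_one_self)
  finally have "D / r / 2 \<le> exp (s\<^sup>2 / 8)" using sD by simp
  then have "exp (- (s\<^sup>2 / 8)) \<le> 2 * r / D"
    using D r by (simp add: exp_minus field_simps)
  then have "exp (- (s\<^sup>2 / 8)) * exp (- (s\<^sup>2 / 8)) \<le> 2 * r / D * exp (- (s\<^sup>2 / 8))"
    by (rule mult_right_mono) simp
  then show ?thesis
    by (simp add: gaussian_eq s_def[symmetric] exp_add[symmetric])
qed

text \<open>
  The three facts about one scale that the multiscale construction needs: the sum over an
  \<open>r\<close>-separated set is bounded, varies slowly at distances below \<open>r\<close>, and is small at distances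
  from the set that are large compared with \<open>r\<close>. All follow from the preceding bound for Gaussians
  of twice the variance.
\<close>

lemma separated_gaussian_sum:
  "\<exists>C\<ge>1. \<forall>(X :: 'a::euclidean_space set) r. finite X \<longrightarrow> pairwise (\<lambda>p q. r \<le> dist p q) X \<longrightarrow> 0 < r \<longrightarrow>
     (\<forall>x. (\<Sum>p\<in>X. gaussian p r x) \<le> C) \<and>
     (\<forall>x y. \<bar>(\<Sum>p\<in>X. gaussian p r x) - (\<Sum>p\<in>X. gaussian p r y)\<bar> \<le> 2 * C / r * norm (x - y)) \<and>
     (\<forall>x D. 0 < D \<longrightarrow> (\<forall>p\<in>X. D \<le> norm (p - x)) \<longrightarrow> (\<Sum>p\<in>X. gaussian p r x) \<le> 2 * C * r / D)"
proof -
  obtain C where C: "1 \<le> C"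
    "\<And>(X :: 'a set) r x. finite X \<Longrightarrow> pairwise (\<lambda>p q. r \<le> dist p q) X \<Longrightarrow> 0 < r \<Longrightarrow>
     (\<Sum>p\<in>X. exp (- ((norm (p - x) / r)\<^sup>2 / 8))) \<le> C"
    using separated_gaussian_sum_bounded by blast
  show ?thesis
  proof (intro exI[of _ C] conjI allI impI C(1))
    fix X :: "'a set" and r :: real
    assume X: "finite X" "pairwise (\<lambda>p q. r \<le> dist p q) X" and r: "0 < r"
    define w where "w p x = exp (- ((norm (p - x) / r)\<^sup>2 / 8))" for p x :: 'a
    have w: "(\<Sum>p\<in>X. w p x) \<le> C" for x
      unfolding w_def by (rule C(2)[OF X r])
    show "(\<Sum>p\<in>X. gaussian p r x) \<le> C" for x
    proof -
      have "gaussian p r x \<le> w p x" for p by (simp add: gaussian_eq w_def)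
      then show ?thesis using w[of x] by (meson order_trans sum_mono)
    qed
    show "\<bar>(\<Sum>p\<in>X. gaussian p r x) - (\<Sum>p\<in>X. gaussian p r y)\<bar> \<le> 2 * C / r * norm (x - y)" for x y
    proof -
      have "\<bar>(\<Sum>p\<in>X. gaussian p r x) - (\<Sum>p\<in>X. gaussian p r y)\<bar>
          \<le> (\<Sum>p\<in>X. \<bar>gaussian p r x - gaussian p r y\<bar>)"
        unfolding sum_subtractf[symmetric] by (rule sum_abs)
      also have "\<dots> \<le> (\<Sum>p\<in>X. norm (x - y) / r * (w p x + w p y))"
        unfolding w_def by (intro sum_mono gaussian_diff_le r)
      also have "\<dots> = norm (x - y) / r * ((\<Sum>p\<in>X. w p x) + (\<Sum>p\<in>X. w p y))"
        by (simp only: sum.distrib[symmetric] sum_distrib_left)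
      also have "\<dots> \<le> norm (x - y) / r * (C + C)"
        using r by (intro mult_left_mono add_mono w) auto
      finally show ?thesis by (simp add: field_simps)
    qed
    show "(\<Sum>p\<in>X. gaussian p r x) \<le> 2 * C * r / D"
      if D: "0 < D" "\<forall>p\<in>X. D \<le> norm (p - x)" for x D
    proof -
      have "(\<Sum>p\<in>X. gaussian p r x) \<le> (\<Sum>p\<in>X. 2 * r / D * w p x)"
        unfolding w_def using D r by (intro sum_mono gaussian_le_inverse_dist) auto
      also have "\<dots> = 2 * r / D * (\<Sum>p\<in>X. w p x)" by (simp add: sum_distrib_left)
      also have "\<dots> \<le> 2 * r / D * C" using D r by (intro mult_left_mono w) auto
      finally show ?thesis by (simp add: field_simps)
    qed
  qed
qed

section \<open>Bounded multiscale sums of Gaussians\<close>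

text \<open>
  Greedy choice of one point for each ball: a ball contributes a point of \<open>S\<close> only if some point of
  \<open>S\<close> is not yet within distance \<open>r\<close> of the chosen ones. This gives a maximal \<open>r\<close>-separated set
  together with the bound on its cardinality that controls the cost below.
\<close>

lemma maximal_separated_subset:
  fixes S :: "'a::metric_space set"
  assumes "finite J" "S \<subseteq> (\<Union>j\<in>J. ball (u j) (d j))" "\<And>j. j \<in> J \<Longrightarrow> 2 * d j \<le> r"
  shows "\<exists>X\<subseteq>S. finite X \<and> card X \<le> card J \<and> pairwise (\<lambda>p q. r \<le> dist p q) X \<and>
    (\<forall>y\<in>S. \<exists>p\<in>X. dist p y < r)"
  using assms
proof (induction J arbitrary: S rule: finite_induct)
  case empty
  then show ?case by (intro exI[of _ "{}"]) auto
next
  case (insert j J)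
  define S0 where "S0 = S \<inter> (\<Union>j\<in>J. ball (u j) (d j))"
  have "\<exists>X\<subseteq>S0. finite X \<and> card X \<le> card J \<and> pairwise (\<lambda>p q. r \<le> dist p q) X \<and>
    (\<forall>y\<in>S0. \<exists>p\<in>X. dist p y < r)"
    using insert.prems by (intro insert.IH) (auto simp: S0_def)
  then obtain X where X: "X \<subseteq> S0" "finite X" "card X \<le> card J" "pairwise (\<lambda>p q. r \<le> dist p q) X"
    "\<And>y. y \<in> S0 \<Longrightarrow> \<exists>p\<in>X. dist p y < r"
    by blast
  show ?case
  proof (cases "\<exists>y0\<in>S. \<forall>p\<in>X. r \<le> dist p y0")
    case False
    then have "\<forall>y\<in>S. \<exists>p\<in>X. dist p y < r" by (auto simp: not_le)
    moreover have "X \<subseteq> S" using X(1) by (auto simp: S0_def)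
    moreover have "card X \<le> card (insert j J)" using X(3) insert.hyps by simp
    ultimately show ?thesis using X(2,4) by blast
  next
    case True
    then obtain y0 where y0: "y0 \<in> S" "\<And>p. p \<in> X \<Longrightarrow> r \<le> dist p y0" by blast
    have ball: "y \<in> ball (u j) (d j)" if "y \<in> S" "\<And>p. p \<in> X \<Longrightarrow> r \<le> dist p y" for y
    proof -
      have "y \<notin> S0" using X(5)[of y] that(2) by (meson not_le)
      then show ?thesis using that(1) insert.prems(1) by (auto simp: S0_def)
    qed
    have "\<exists>p\<in>insert y0 X. dist p y < r" if y: "y \<in> S" for y
    proof (cases "\<exists>p\<in>X. dist p y < r")
      case False
      then have "y \<in> ball (u j) (d j)" using y by (intro ball) (auto simp: not_less)
      moreover have "y0 \<in> ball (u j) (d j)" using y0 by (rule ball)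
      ultimately have "dist y0 y < 2 * d j"
        using dist_triangle3[of y0 y "u j"] by simp
      then show ?thesis using insert.prems(2)[of j] by auto
    qed auto
    moreover have "pairwise (\<lambda>p q. r \<le> dist p q) (insert y0 X)"
      using X(4) y0(2) by (auto simp: pairwise_insert dist_commute)
    moreover have "card (insert y0 X) \<le> card (insert j J)"
      using X(2,3) insert.hyps by (simp add: card_insert_if)
    moreover have "insert y0 X \<subseteq> S" "finite (insert y0 X)"
      using X(1,2) y0(1) by (auto simp: S0_def)
    ultimately show ?thesis by blast
  qed
qed

definition gauss_sum :: "('a::real_normed_vector \<times> real) set \<Rightarrow> 'a \<Rightarrow> real" where
  "gauss_sum P x = (\<Sum>(p, r)\<in>P. gaussian p r x)"

lemma gauss_sum_nonneg [simp]: "0 \<le> gauss_sum P x"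
  by (auto simp: gauss_sum_def intro!: sum_nonneg)

lemma gauss_sum_Un_scale:
  assumes "finite P" "finite X" "r \<notin> snd ` P"
  shows "gauss_sum (P \<union> X \<times> {r}) x = gauss_sum P x + (\<Sum>p\<in>X. gaussian p r x)"
proof -
  have "gauss_sum (P \<union> X \<times> {r}) x = gauss_sum P x + gauss_sum (X \<times> {r}) x"
    unfolding gauss_sum_def using assms by (intro sum.union_disjoint) force+
  also have "gauss_sum (X \<times> {r}) x = (\<Sum>p\<in>X. gaussian p r x)"
    unfolding gauss_sum_def by (subst sum.cartesian_product[symmetric]) simp
  finally show ?thesis .
qed

text \<open>
  A cover of \<open>K\<close> by balls of very different sizes is turned into a sum of Gaussians that is bounded
  below on \<open>K\<close> and bounded above everywhere by a constant that depends on the dimension only. Simply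
  adding one Gaussian per ball could give a sum as large as the number of scales. Therefore the
  scales are processed from large to small, and at scale \<open>R n\<close> only those points of \<open>K\<close> receive a
  new Gaussian at which the sum so far is still below the threshold \<open>c\<close>; among these points a
  maximal \<open>R n\<close>-separated set is enough.
  
  For the upper bound consider a point \<open>x\<close>. If \<open>x\<close> is further than \<open>D\<close> from all new centres, the
  new Gaussians add at most \<open>(1 / 2) ^ n\<close>. Otherwise \<open>x\<close> is so close to a new centre \<open>p\<close> that the
  old sum, whose Lipschitz constant \<open>L\<close> is that of the larger scales, is at \<open>x\<close> hardly larger than at
  \<open>p\<close>, where it is below \<open>c\<close>; so the total starts afresh from a bounded value. The hypothesis
  \<open>gap\<close> says precisely that \<open>L * D \<le> 1\<close>. The hypothesis \<open>sep\<close> fixes a constant as provided by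
  \<open>separated_gaussian_sum\<close>.
\<close>

lemma multiscale_gaussian_cover:
  fixes K :: "'a::euclidean_space set" and R :: "nat \<Rightarrow> real" and C :: real
  assumes C: "1 \<le> C"
    and sep: "\<And>(X :: 'a set) r. finite X \<Longrightarrow> pairwise (\<lambda>p q. r \<le> dist p q) X \<Longrightarrow> 0 < r \<Longrightarrow>
     (\<forall>x. (\<Sum>p\<in>X. gaussian p r x) \<le> C) \<and>
     (\<forall>x y. \<bar>(\<Sum>p\<in>X. gaussian p r x) - (\<Sum>p\<in>X. gaussian p r y)\<bar> \<le> 2 * C / r * norm (x - y)) \<and>
     (\<forall>x D. 0 < D \<longrightarrow> (\<forall>p\<in>X. D \<le> norm (p - x)) \<longrightarrow> (\<Sum>p\<in>X. gaussian p r x) \<le> 2 * C * r / D)"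
    and R: "\<And>k. 0 < R k" "inj R"
    and gap: "\<And>n. (\<Sum>i<n. 2 * C / R i) * (2 * C * 2 ^ n * R n) \<le> 1"
    and J: "finite J" "K \<subseteq> (\<Union>j\<in>J. ball (u j) (d j))" "\<And>j. j \<in> J \<Longrightarrow> 2 * d j \<le> R (k j)"
  shows "\<exists>P. finite P \<and> P \<subseteq> K \<times> {0<..} \<and> (\<forall>x. gauss_sum P x \<le> C + 4) \<and>
    (\<forall>y\<in>K. exp (- (1 / 4)) \<le> gauss_sum P y) \<and>
    (\<Sum>(p, r)\<in>P. r powr \<beta>) \<le> (\<Sum>j\<in>J. R (k j) powr \<beta>)"
proof -
  define c :: real where "c = exp (- (1 / 4))"
  have c: "c \<le> 1" by (simp add: c_def)
  have step: "\<exists>P. finite P \<and> P \<subseteq> K \<times> R ` {..<n} \<and>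
      (\<forall>x. gauss_sum P x \<le> C + 2 + (\<Sum>i<n. (1 / 2) ^ i)) \<and>
      (\<forall>x y. \<bar>gauss_sum P x - gauss_sum P y\<bar> \<le> (\<Sum>i<n. 2 * C / R i) * norm (x - y)) \<and>
      (\<forall>j\<in>J. k j < n \<longrightarrow> (\<forall>y\<in>K \<inter> ball (u j) (d j). c \<le> gauss_sum P y)) \<and>
      (\<Sum>(p, r)\<in>P. r powr \<beta>) \<le> (\<Sum>j\<in>{j\<in>J. k j < n}. R (k j) powr \<beta>)" for n
  proof (induction n)
    case 0
    show ?case using C by (intro exI[of _ "{}"]) (auto simp: gauss_sum_def)
  next
    case (Suc n)
    define L where "L = (\<Sum>i<n. 2 * C / R i)"
    \<comment> \<open>at distance \<open>D\<close> the tail bound \<open>2 * C * R n / D\<close> equals \<open>(1 / 2) ^ n\<close>\<close>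
    define D where "D = 2 * C * 2 ^ n * R n"
    have L: "0 \<le> L" unfolding L_def using C R(1) by (intro sum_nonneg) (simp add: less_imp_le)
    have D: "0 < D" unfolding D_def using C R(1)[of n] by simp
    have LD: "L * D \<le> 1" unfolding L_def D_def by (rule gap)
    obtain P where P: "finite P" "P \<subseteq> K \<times> R ` {..<n}"
        "\<And>x. gauss_sum P x \<le> C + 2 + (\<Sum>i<n. (1 / 2) ^ i)"
        "\<And>x y. \<bar>gauss_sum P x - gauss_sum P y\<bar> \<le> L * norm (x - y)"
        "\<And>j y. j \<in> J \<Longrightarrow> k j < n \<Longrightarrow> y \<in> K \<inter> ball (u j) (d j) \<Longrightarrow> c \<le> gauss_sum P y"
        "(\<Sum>(p, r)\<in>P. r powr \<beta>) \<le> (\<Sum>j\<in>{j\<in>J. k j < n}. R (k j) powr \<beta>)"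
      using Suc unfolding L_def[symmetric] by blast
    define Jn where "Jn = {j\<in>J. k j = n}"
    define S where "S = {y \<in> K \<inter> (\<Union>j\<in>Jn. ball (u j) (d j)). gauss_sum P y < c}"
    have "\<exists>X\<subseteq>S. finite X \<and> card X \<le> card Jn \<and> pairwise (\<lambda>p q. R n \<le> dist p q) X \<and>
        (\<forall>y\<in>S. \<exists>p\<in>X. dist p y < R n)"
      using J by (intro maximal_separated_subset[of _ _ u d]) (auto simp: S_def Jn_def)
    then obtain X where X: "X \<subseteq> S" "finite X" "card X \<le> card Jn"
        "pairwise (\<lambda>p q. R n \<le> dist p q) X" "\<And>y. y \<in> S \<Longrightarrow> \<exists>p\<in>X. dist p y < R n"
      by blast
    define G where "G x = (\<Sum>p\<in>X. gaussian p (R n) x)" for x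
    have G: "G x \<le> C" "\<bar>G x - G y\<bar> \<le> 2 * C / R n * norm (x - y)"
      "(\<forall>p\<in>X. D \<le> norm (p - x)) \<Longrightarrow> G x \<le> 2 * C * R n / D" for x y
      unfolding G_def using sep[OF X(2,4) R(1)] D by blast+
    have G0: "0 \<le> G x" for x unfolding G_def by (intro sum_nonneg) simp
    have new: "R n \<notin> snd ` P"
    proof
      assume "R n \<in> snd ` P"
      then obtain i where "i < n" "R n = R i" using P(2) by auto
      then show False using injD[OF R(2), of n i] by simp
    qed
    define P' where "P' = P \<union> X \<times> {R n}"
    have P': "gauss_sum P' x = gauss_sum P x + G x" for x
      unfolding P'_def G_def by (rule gauss_sum_Un_scale[OF P(1) X(2) new])
    have upper: "gauss_sum P' x \<le> C + 2 + (\<Sum>i<Suc n. (1 / 2) ^ i)" for x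
    proof (cases "\<forall>p\<in>X. D \<le> norm (p - x)")
      case True
      have "G x \<le> 2 * C * R n / D" by (rule G(3)[OF True])
      also have "\<dots> = (1 / 2) ^ n"
        using C R(1)[of n] by (simp add: D_def field_simps)
      finally show ?thesis using P(3)[of x] by (simp add: P')
    next
      case False
      then obtain p where p: "p \<in> X" "norm (p - x) < D" by (auto simp: not_le)
      have "gauss_sum P x \<le> gauss_sum P p + L * norm (x - p)"
        using P(4)[of x p] by linarith
      also have "\<dots> \<le> c + L * D"
        using p X(1) L by (intro add_mono mult_left_mono) (auto simp: S_def norm_minus_commute)
      also have "\<dots> \<le> 2" using c LD by simp
      finally have "gauss_sum P' x \<le> C + 2" using G(1)[of x] by (simp add: P')
      also have "\<dots> \<le> C + 2 + (\<Sum>i<Suc n. (1 / 2) ^ i)" by (simp add: sum_nonneg)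
      finally show ?thesis .
    qed
    have lip: "\<bar>gauss_sum P' x - gauss_sum P' y\<bar> \<le> (\<Sum>i<Suc n. 2 * C / R i) * norm (x - y)" for x y
    proof -
      have "\<bar>gauss_sum P' x - gauss_sum P' y\<bar> \<le> L * norm (x - y) + 2 * C / R n * norm (x - y)"
        using P(4)[of x y] G(2)[of x y] unfolding P' by linarith
      then show ?thesis by (simp add: L_def algebra_simps)
    qed
    have lower: "c \<le> gauss_sum P' y"
      if j: "j \<in> J" "k j < Suc n" "y \<in> K \<inter> ball (u j) (d j)" for j y
    proof (cases "c \<le> gauss_sum P y")
      case True
      then show ?thesis using G0[of y] by (simp add: P')
    next
      case False
      then have "k j = n" using P(5)[of j y] j by force
      then have "y \<in> S" using False j by (auto simp: S_def Jn_def)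
      then obtain p where p: "p \<in> X" "dist p y < R n" using X(5) by blast
      have "(norm (p - y) / R n)\<^sup>2 \<le> 1"
        using p(2) R(1)[of n] by (intro power_le_one) (auto simp: dist_norm)
      then have "c \<le> gaussian p (R n) y" by (simp add: c_def gaussian_eq)
      also have "\<dots> \<le> G y" unfolding G_def using X(2) p(1) by (intro member_le_sum) auto
      also have "\<dots> \<le> gauss_sum P' y" by (simp add: P')
      finally show ?thesis .
    qed
    have cost: "(\<Sum>(p, r)\<in>P'. r powr \<beta>) \<le> (\<Sum>j\<in>{j\<in>J. k j < Suc n}. R (k j) powr \<beta>)"
    proof -
      have "(\<Sum>(p, r)\<in>P'. r powr \<beta>) = (\<Sum>(p, r)\<in>P. r powr \<beta>) + (\<Sum>(p, r)\<in>X \<times> {R n}. r powr \<beta>)"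
        unfolding P'_def using P(1) X(2) new by (intro sum.union_disjoint) force+
      also have "(\<Sum>(p, r)\<in>X \<times> {R n}. r powr \<beta>) = card X * R n powr \<beta>"
        by (subst sum.cartesian_product[symmetric]) simp
      also have "\<dots> \<le> card Jn * R n powr \<beta>"
        using X(3) by (intro mult_right_mono) auto
      also have "\<dots> = (\<Sum>j\<in>Jn. R (k j) powr \<beta>)" by (simp add: Jn_def)
      also have "(\<Sum>(p, r)\<in>P. r powr \<beta>) + (\<Sum>j\<in>Jn. R (k j) powr \<beta>)
          \<le> (\<Sum>j\<in>{j\<in>J. k j < n}. R (k j) powr \<beta>) + (\<Sum>j\<in>Jn. R (k j) powr \<beta>)"
        using P(6) by simp
      also have "\<dots> = (\<Sum>j\<in>{j\<in>J. k j < n} \<union> Jn. R (k j) powr \<beta>)"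
        using J(1) by (intro sum.union_disjoint[symmetric]) (auto simp: Jn_def)
      also have "{j\<in>J. k j < n} \<union> Jn = {j\<in>J. k j < Suc n}" by (auto simp: Jn_def)
      finally show ?thesis by simp
    qed
    have "P' \<subseteq> K \<times> R ` {..<Suc n}"
      using P(2) X(1) by (fastforce simp: P'_def S_def)
    moreover have "finite P'" using P(1) X(2) by (simp add: P'_def)
    ultimately show ?case
      using upper lip lower cost by (intro exI[of _ P']) blast
  qed
  obtain N where N: "\<And>j. j \<in> J \<Longrightarrow> k j < N"
    using finite_nat_set_iff_bounded[of "k ` J"] J(1) by auto
  obtain P where P: "finite P" "P \<subseteq> K \<times> R ` {..<N}"
      "\<And>x. gauss_sum P x \<le> C + 2 + (\<Sum>i<N. (1 / 2) ^ i)"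
      "\<And>j y. j \<in> J \<Longrightarrow> k j < N \<Longrightarrow> y \<in> K \<inter> ball (u j) (d j) \<Longrightarrow> c \<le> gauss_sum P y"
      "(\<Sum>(p, r)\<in>P. r powr \<beta>) \<le> (\<Sum>j\<in>{j\<in>J. k j < N}. R (k j) powr \<beta>)"
    using step[of N] by blast
  have "(\<Sum>i<N. (1 / 2 :: real) ^ i) \<le> 2"
    by (simp add: sum_gp_strict)
  then have "gauss_sum P x \<le> C + 4" for x using P(3)[of x] by linarith
  moreover have "c \<le> gauss_sum P y" if "y \<in> K" for y
    using that J(2) N P(4) by blast
  moreover have "{j\<in>J. k j < N} = J" using N by blast
  ultimately show ?thesis
    using P R(1) by (intro exI[of _ P]) (auto simp: c_def)
qed

section \<open>Gaussian potentials of sets of Hausdorff measure zero\<close>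

text \<open>
  Sets of small total \<open>s\<close>-dimensional size are enlarged to open balls, so that compactness leaves
  finitely many of them.
\<close>

lemma hausdorff_null_ball_cover:
  fixes K :: "'a::metric_space set"
  assumes s: "0 < s" and null: "hausdorff_measure s K = 0" and K: "compact K" and \<epsilon>: "0 < \<epsilon>"
  shows "\<exists>(J :: nat set) u d. finite J \<and> K \<subseteq> (\<Union>j\<in>J. ball (u j) (d j)) \<and> (\<forall>j\<in>J. 0 < d j) \<and>
    (\<Sum>j\<in>J. d j powr s) \<le> \<epsilon>"
proof -
  have "hausdorff_premeasure s 1 K \<le> hausdorff_measure s K"
    unfolding hausdorff_measure_def by (rule SUP_upper) simp
  with null \<epsilon> have "hausdorff_premeasure s 1 K < ennreal (\<epsilon> / 2)" by simp
  then obtain U :: "nat \<Rightarrow> 'a set" where U: "\<And>i. bounded (U i)" "K \<subseteq> (\<Union>i. U i)"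
      "(\<Sum>i. ennreal (diameter (U i) powr s)) < ennreal (\<epsilon> / 2)"
    unfolding hausdorff_premeasure_def by (auto simp: INF_less_iff)
  \<comment> \<open>sets of diameter \<open>0\<close> also need a ball of positive radius around them\<close>
  define d where "d j = (diameter (U j) powr s + \<epsilon> / 4 * (1 / 2) ^ j) powr (1 / s)" for j
  define u where "u j = (SOME x. x \<in> U j)" for j
  have pos: "0 < diameter (U j) powr s + \<epsilon> / 4 * (1 / 2) ^ j" for j
    using \<epsilon> by (intro add_nonneg_pos) auto
  have d_powr: "d j powr s = diameter (U j) powr s + \<epsilon> / 4 * (1 / 2) ^ j" for j
    unfolding d_def using s pos[of j] by (simp add: powr_powr)
  have d_pos: "0 < d j" for j
    unfolding d_def using pos[of j] by simp
  have diam: "diameter (U j) < d j" for j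
  proof (rule ccontr)
    assume "\<not> diameter (U j) < d j"
    then have "d j powr s \<le> diameter (U j) powr s"
      using d_pos[of j] s by (intro powr_mono2) auto
    moreover have "0 < \<epsilon> / 4 * (1 / 2) ^ j" using \<epsilon> by simp
    ultimately show False by (simp add: d_powr)
  qed
  have sub: "U j \<subseteq> ball (u j) (d j)" for j
  proof
    fix x assume x: "x \<in> U j"
    then have "u j \<in> U j" unfolding u_def by (rule someI)
    then have "dist (u j) x \<le> diameter (U j)"
      using x U(1) by (intro diameter_bounded_bound) auto
    then show "x \<in> ball (u j) (d j)" using diam[of j] by simp
  qed
  have "K \<subseteq> (\<Union>j\<in>UNIV. ball (u j) (d j))" using U(2) sub by blast
  then obtain J where J: "finite J" "K \<subseteq> (\<Union>j\<in>J. ball (u j) (d j))"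
    using compactE_image[OF K, of UNIV "\<lambda>j. ball (u j) (d j)"] by (auto simp del: mem_ball)
  have "ennreal (\<Sum>j\<in>J. diameter (U j) powr s) = (\<Sum>j\<in>J. ennreal (diameter (U j) powr s))"
    by (intro sum_ennreal[symmetric]) auto
  also have "\<dots> \<le> (\<Sum>j. ennreal (diameter (U j) powr s))"
    using J(1) by (intro sum_le_suminf) auto
  also have "\<dots> \<le> ennreal (\<epsilon> / 2)" using U(3) by simp
  finally have 1: "(\<Sum>j\<in>J. diameter (U j) powr s) \<le> \<epsilon> / 2"
    using \<epsilon> by (simp add: ennreal_le_iff)
  have "(\<Sum>j\<in>J. (1 / 2 :: real) ^ j) \<le> (\<Sum>j. (1 / 2) ^ j)"
    using J(1) by (intro sum_le_suminf) (auto intro: summable_geometric)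
  also have "\<dots> = 2" by (simp add: suminf_geometric)
  finally have "\<epsilon> / 4 * (\<Sum>j\<in>J. (1 / 2 :: real) ^ j) \<le> \<epsilon> / 4 * 2"
    using \<epsilon> by (intro mult_left_mono) auto
  with 1 have "(\<Sum>j\<in>J. d j powr s) \<le> \<epsilon>"
    by (simp add: d_powr sum.distrib sum_distrib_left)
  then show ?thesis using J d_pos by blast
qed

text \<open>
  The recursion \<open>R (Suc k) = R k powr (\<beta> / \<alpha>)\<close> makes the scales so sparse that the gap condition of
  \<open>multiscale_gaussian_cover\<close> holds, and at the same time rounding a radius up to the next scale does
  no harm: a radius between \<open>R (Suc k)\<close> and \<open>R k\<close> is replaced by \<open>R k\<close>, and its cost in the larger
  dimension \<open>\<beta>\<close> is \<open>R k powr \<beta> = R (Suc k) powr \<alpha>\<close>, at most its cost in dimension \<open>\<alpha>\<close>. This is where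
  the strict inequality \<open>\<alpha> < \<beta>\<close> is used.
\<close>

lemma superexponential_scales:
  fixes \<alpha> \<beta> C :: real
  assumes ab: "0 < \<alpha>" "\<alpha> < \<beta>" "\<beta> \<le> 2 * \<alpha>" and C: "1 \<le> C"
  shows "\<exists>R :: nat \<Rightarrow> real. (\<forall>k. 0 < R k) \<and> inj R \<and> R \<longlonglongrightarrow> 0 \<and>
    (\<forall>k. R k powr \<beta> = R (Suc k) powr \<alpha>) \<and>
    (\<forall>n. (\<Sum>i<n. 2 * C / R i) * (2 * C * 2 ^ n * R n) \<le> 1)"
proof -
  define A where "A = \<beta> / \<alpha>"
  define a where "a = A - 1"
  \<comment> \<open>\<open>R (Suc k) \<le> \<theta> ^ Suc k * R k\<close> will hold, which reduces the gap condition to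
    \<open>4 * C\<^sup>2 * (4 * \<theta>) \<le> 1\<close>; the exponent in \<open>\<rho>\<close> comes from Bernoulli's inequality \<open>A ^ k \<ge> a * Suc k\<close>\<close>
  define \<theta> where "\<theta> = 1 / (16 * C\<^sup>2)"
  define \<rho> where "\<rho> = \<theta> powr (1 / a\<^sup>2)"
  define R where "R k = \<rho> powr (A ^ k)" for k :: nat
  have a: "0 < a" "a \<le> 1" using ab by (simp_all add: a_def A_def field_simps)
  have C2: "1 \<le> C\<^sup>2" using C by (simp add: one_le_power)
  have \<theta>: "0 < \<theta>" using C by (simp add: \<theta>_def)
  have "4 * \<theta> = 1 / (4 * C\<^sup>2)" by (simp add: \<theta>_def)
  also have "\<dots> \<le> 1" using C2 by (subst divide_le_eq_1_pos) linarith+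
  finally have \<theta>1: "4 * \<theta> \<le> 1" .
  note \<theta> = \<theta> \<theta>1
  have \<rho>: "0 < \<rho>" "\<rho> \<le> 1"
    using \<theta> a by (simp_all add: \<rho>_def powr_le1)
  have R: "0 < R k" for k using \<rho> by (simp add: R_def)
  have R_Suc: "R (Suc k) = R k powr A" for k
    by (simp add: R_def powr_powr mult.commute)
  have drop: "R (Suc k) \<le> \<theta> ^ Suc k * R k" for k
  proof -
    have "a * real (Suc k) \<le> 1 + real k * a" using a by (simp add: algebra_simps)
    also have "\<dots> \<le> (1 + a) ^ k" using a by (intro Bernoulli_inequality) auto
    finally have "a\<^sup>2 * real (Suc k) \<le> a * A ^ k"
      using a by (simp add: a_def power2_eq_square mult.assoc)
    then have "\<rho> powr (a * A ^ k) \<le> \<rho> powr (a\<^sup>2 * real (Suc k))"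
      using \<rho> by (intro powr_mono') auto
    also have "\<dots> = \<theta> powr real (Suc k)"
      using a \<theta>(1) by (simp add: \<rho>_def powr_powr)
    also have "\<dots> = \<theta> ^ Suc k" using \<theta> by (simp add: powr_realpow del: of_nat_Suc)
    finally have *: "R k powr a \<le> \<theta> ^ Suc k"
      by (simp add: R_def powr_powr mult.commute)
    have "R (Suc k) = R k powr a * R k"
      using R[of k] powr_add[of "R k" a 1] by (simp add: R_Suc a_def)
    also have "\<dots> \<le> \<theta> ^ Suc k * R k" using * R[of k] by (intro mult_right_mono) auto
    finally show ?thesis .
  qed
  have less: "R (Suc k) < R k" for k
  proof -
    have "\<theta> ^ Suc k \<le> \<theta>" using \<theta> by (simp add: mult_left_le power_le_one)
    then have "\<theta> ^ Suc k < 1" using \<theta> by linarith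
    then have "\<theta> ^ Suc k * R k < 1 * R k" using R[of k] by (rule mult_strict_right_mono)
    with drop[of k] show ?thesis by simp
  qed
  have "strict_mono (\<lambda>k. - R k)" by (simp add: strict_mono_Suc_iff less)
  then have "inj (\<lambda>k. - R k)" by (rule strict_mono_imp_inj_on)
  then have inj: "inj R" by (simp add: inj_def)
  have "R n \<le> \<rho> * \<theta> ^ n" for n
  proof (induction n)
    case (Suc n)
    have "\<theta> ^ Suc n \<le> \<theta>" using \<theta> by (simp add: mult_left_le power_le_one)
    then have "\<theta> ^ Suc n * R n \<le> \<theta> * R n" using R[of n] by (intro mult_right_mono) auto
    also have "\<dots> \<le> \<theta> * (\<rho> * \<theta> ^ n)" using Suc \<theta> by (intro mult_left_mono) auto
    finally show ?case using drop[of n] by (simp add: ac_simps)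
  qed (use \<rho> in \<open>simp add: R_def\<close>)
  then have lim: "R \<longlonglongrightarrow> 0"
  proof (intro tendsto_sandwich[of "\<lambda>_. 0" R sequentially "\<lambda>n. \<rho> * \<theta> ^ n" 0])
    have "(\<lambda>n. \<rho> * \<theta> ^ n) \<longlonglongrightarrow> \<rho> * 0"
      using \<theta> by (intro tendsto_mult_left LIMSEQ_power_zero) auto
    then show "(\<lambda>n. \<rho> * \<theta> ^ n) \<longlonglongrightarrow> 0" by simp
  qed (use R in \<open>auto simp: less_imp_le\<close>)
  have powr: "R k powr \<beta> = R (Suc k) powr \<alpha>" for k
    using ab by (simp add: R_Suc powr_powr A_def)
  have gap: "(\<Sum>i<n. 2 * C / R i) * (2 * C * 2 ^ n * R n) \<le> 1" for n
  proof (cases n)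
    case (Suc m)
    have anti: "R m \<le> R i" if "i < n" for i
      using lift_Suc_antimono_le[of R i m] less that Suc by (simp add: less_imp_le)
    have "(\<Sum>i<n. 2 * C / R i) * (2 * C * 2 ^ n * R n) = (\<Sum>i<n. 4 * C\<^sup>2 * 2 ^ n * (R n / R i))"
      unfolding sum_distrib_right by (intro sum.cong) (simp_all add: power2_eq_square)
    also have "\<dots> \<le> (\<Sum>i<n. 4 * C\<^sup>2 * 2 ^ n * \<theta> ^ n)"
    proof (intro sum_mono mult_left_mono)
      fix i assume "i \<in> {..<n}"
      then have "\<theta> ^ n * R m \<le> \<theta> ^ n * R i" using anti[of i] \<theta> by (intro mult_left_mono) auto
      then have "R n \<le> \<theta> ^ n * R i" using drop[of m] Suc by simp
      then show "R n / R i \<le> \<theta> ^ n" using R[of i] by (simp add: field_simps)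
    qed (use C in auto)
    also have "\<dots> = real n * (4 * C\<^sup>2 * (2 * \<theta>) ^ n)" by (simp add: power_mult_distrib)
    also have "\<dots> \<le> 2 ^ n * (4 * C\<^sup>2 * (2 * \<theta>) ^ n)"
    proof (rule mult_right_mono)
      show "real n \<le> 2 ^ n" by (rule less_imp_le[OF of_nat_less_two_power])
    qed (use \<theta> in simp)
    also have "\<dots> = 4 * C\<^sup>2 * (2 * (2 * \<theta>)) ^ n"
      unfolding power_mult_distrib[of 2 "2 * \<theta>"] by (simp only: ac_simps)
    also have "2 * (2 * \<theta>) = 4 * \<theta>" by simp
    also have "4 * C\<^sup>2 * (4 * \<theta>) ^ n \<le> 4 * C\<^sup>2 * (4 * \<theta>)"
    proof (rule mult_left_mono)
      show "(4 * \<theta>) ^ n \<le> 4 * \<theta>"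
        using power_decreasing[of 1 n "4 * \<theta>"] \<theta> Suc by simp
    qed simp
    also have "\<dots> = 1" using C by (simp add: \<theta>_def)
    finally show ?thesis .
  qed simp
  show ?thesis
    by (intro exI[of _ R] conjI allI R inj lim powr gap)
qed

text \<open>
  A capacity statement: a compact set of \<open>\<alpha>\<close>-dimensional Hausdorff measure zero carries Gaussian
  sums of arbitrarily small \<open>\<beta>\<close>-dimensional cost that are at least a fixed constant on the set and
  at most \<open>B\<close> everywhere. It is essential for the later limit arguments that \<open>B\<close> stays the same as
  the cost tends to zero.
\<close>

lemma gaussian_potential_of_null_set:
  assumes ab: "0 < \<alpha>" "\<alpha> < \<beta>" "\<beta> \<le> 2 * \<alpha>"
  shows "\<exists>B. \<forall>(K :: 'a::euclidean_space set) \<eta>.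
    compact K \<longrightarrow> hausdorff_measure \<alpha> K = 0 \<longrightarrow> 0 < \<eta> \<longrightarrow>
    (\<exists>P. finite P \<and> P \<subseteq> K \<times> {0<..} \<and> (\<forall>x. gauss_sum P x \<le> B) \<and>
      (\<forall>y\<in>K. exp (- (1 / 4)) \<le> gauss_sum P y) \<and> (\<Sum>(p, r)\<in>P. r powr \<beta>) \<le> \<eta>)"
proof -
  obtain C where C: "1 \<le> C" and sep: "\<And>(X :: 'a set) r. finite X \<Longrightarrow>
     pairwise (\<lambda>p q. r \<le> dist p q) X \<Longrightarrow> 0 < r \<Longrightarrow>
     (\<forall>x. (\<Sum>p\<in>X. gaussian p r x) \<le> C) \<and>
     (\<forall>x y. \<bar>(\<Sum>p\<in>X. gaussian p r x) - (\<Sum>p\<in>X. gaussian p r y)\<bar> \<le> 2 * C / r * norm (x - y)) \<and>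
     (\<forall>x D. 0 < D \<longrightarrow> (\<forall>p\<in>X. D \<le> norm (p - x)) \<longrightarrow> (\<Sum>p\<in>X. gaussian p r x) \<le> 2 * C * r / D)"
    using separated_gaussian_sum by blast
  obtain R :: "nat \<Rightarrow> real" where R: "\<And>k. 0 < R k" "inj R" "R \<longlonglongrightarrow> 0"
      "\<And>k. R k powr \<beta> = R (Suc k) powr \<alpha>"
      "\<And>n. (\<Sum>i<n. 2 * C / R i) * (2 * C * 2 ^ n * R n) \<le> 1"
    using superexponential_scales[OF ab C] by blast
  show ?thesis
  proof (intro exI[of _ "C + 4"] allI impI)
    fix K :: "'a set" and \<eta> :: real
    assume K: "compact K" "hausdorff_measure \<alpha> K = 0" and \<eta>: "0 < \<eta>"
    define \<epsilon> where "\<epsilon> = min (\<eta> / 2 powr \<alpha>) ((R 0 / 2) powr \<alpha>)"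
    have "0 < \<epsilon>" using \<eta> R(1)[of 0] by (simp add: \<epsilon>_def)
    from hausdorff_null_ball_cover[OF ab(1) K(2,1) this]
    obtain J :: "nat set" and u d where J': "finite J \<and> K \<subseteq> (\<Union>j\<in>J. ball (u j) (d j)) \<and>
        (\<forall>j\<in>J. 0 < d j) \<and> (\<Sum>j\<in>J. d j powr \<alpha>) \<le> \<epsilon>"
      by (elim exE)
    then have J: "finite J" "K \<subseteq> (\<Union>j\<in>J. ball (u j) (d j))"
        "\<And>j. j \<in> J \<Longrightarrow> 0 < d j" "(\<Sum>j\<in>J. d j powr \<alpha>) \<le> \<epsilon>"
      by simp_all
    have small: "2 * d j \<le> R 0" if j: "j \<in> J" for j
    proof (rule ccontr)
      assume "\<not> 2 * d j \<le> R 0"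
      then have "(R 0 / 2) powr \<alpha> < d j powr \<alpha>"
        using R(1)[of 0] ab(1) by (intro powr_less_mono2) auto
      also have "\<dots> \<le> (\<Sum>j\<in>J. d j powr \<alpha>)"
        using J(1) j by (intro member_le_sum) auto
      finally show False using J(4) by (simp add: \<epsilon>_def)
    qed
    have "\<exists>k. R (Suc k) < 2 * d j \<and> 2 * d j \<le> R k" if j: "j \<in> J" for j
    proof -
      have "eventually (\<lambda>n. R n < 2 * d j) sequentially"
        using R(3) J(3)[OF j] by (intro order_tendstoD(2)) auto
      then obtain m where m: "R m < 2 * d j" by (auto simp: eventually_sequentially)
      define n where "n = (LEAST n. R n < 2 * d j)"
      have n: "R n < 2 * d j" unfolding n_def by (rule LeastI[of _ m]) (rule m)
      with small[OF j] obtain k where k: "n = Suc k" by (cases n) auto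
      have "\<not> R k < 2 * d j" using not_less_Least[of k "\<lambda>n. R n < 2 * d j"] k n_def by simp
      with n k show ?thesis by (auto simp: not_less)
    qed
    then obtain k where k: "\<And>j. j \<in> J \<Longrightarrow> R (Suc (k j)) < 2 * d j" "\<And>j. j \<in> J \<Longrightarrow> 2 * d j \<le> R (k j)"
      by metis
    obtain P where P: "finite P" "P \<subseteq> K \<times> {0<..}" "\<And>x. gauss_sum P x \<le> C + 4"
        "\<And>y. y \<in> K \<Longrightarrow> exp (- (1 / 4)) \<le> gauss_sum P y"
        "(\<Sum>(p, r)\<in>P. r powr \<beta>) \<le> (\<Sum>j\<in>J. R (k j) powr \<beta>)"
      using multiscale_gaussian_cover[OF C sep R(1,2,5) J(1,2) k(2), of \<beta>] by blast
    note P(5)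
    also have "(\<Sum>j\<in>J. R (k j) powr \<beta>) \<le> (\<Sum>j\<in>J. 2 powr \<alpha> * d j powr \<alpha>)"
    proof (rule sum_mono)
      fix j assume j: "j \<in> J"
      have "R (k j) powr \<beta> = R (Suc (k j)) powr \<alpha>" by (rule R(4))
      also have "\<dots> \<le> (2 * d j) powr \<alpha>"
        using k(1)[OF j] R(1)[of "Suc (k j)"] ab(1) by (intro powr_mono2) auto
      also have "\<dots> = 2 powr \<alpha> * d j powr \<alpha>" using J(3)[OF j] by (simp add: powr_mult)
      finally show "R (k j) powr \<beta> \<le> 2 powr \<alpha> * d j powr \<alpha>" .
    qed
    also have "\<dots> \<le> 2 powr \<alpha> * \<epsilon>"
      using J(4) by (simp add: sum_distrib_left[symmetric])
    also have "\<dots> \<le> 2 powr \<alpha> * (\<eta> / 2 powr \<alpha>)"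
      by (intro mult_left_mono) (simp_all add: \<epsilon>_def)
    finally have "(\<Sum>(p, r)\<in>P. r powr \<beta>) \<le> \<eta>" by simp
    with P show "\<exists>P. finite P \<and> P \<subseteq> K \<times> {0<..} \<and> (\<forall>x. gauss_sum P x \<le> C + 4) \<and>
      (\<forall>y\<in>K. exp (- (1 / 4)) \<le> gauss_sum P y) \<and> (\<Sum>(p, r)\<in>P. r powr \<beta>) \<le> \<eta>"
      by blast
  qed
qed

section \<open>Regularity and decay of Gaussian sums\<close>

lemma continuous_on_gaussian: "continuous_on S (gaussian p r)"
  unfolding gaussian_def divide_inverse by (intro continuous_intros)

lemma tendsto_gaussian_at_infinity:
  fixes p :: "'a::real_normed_vector"
  assumes r: "0 < r"
  shows "(gaussian p r \<longlongrightarrow> 0) at_infinity"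
proof (rule tendsto_sandwich[of "\<lambda>_. 0" _ _ "\<lambda>x. 2 * r / norm (p - x)"])
  show "\<forall>\<^sub>F x in at_infinity. gaussian p r x \<le> 2 * r / norm (p - x)"
    unfolding eventually_at_infinity
  proof (intro exI[of _ "norm p + 1"] allI impI)
    fix x :: 'a assume "norm p + 1 \<le> norm x"
    then have D: "0 < norm (p - x)" by auto
    have "gaussian p r x \<le> 2 * r / norm (p - x) * exp (- ((norm (p - x) / r)\<^sup>2 / 8))"
      using r D by (intro gaussian_le_inverse_dist) auto
    also have "\<dots> \<le> 2 * r / norm (p - x) * 1"
      using r D by (intro mult_left_mono) auto
    finally show "gaussian p r x \<le> 2 * r / norm (p - x)" by simp
  qed
  have "filterlim (\<lambda>x. norm (p - x)) at_top at_infinity"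
  proof (rule filterlim_at_top_mono)
    show "filterlim (\<lambda>x. - norm p + norm x) at_top (at_infinity :: 'a filter)"
      by (intro filterlim_tendsto_add_at_top[OF tendsto_const] filterlim_norm_at_top)
    have "- norm p + norm x \<le> norm (p - x)" for x :: 'a
      using norm_triangle_ineq2[of x p] by (simp add: norm_minus_commute)
    then show "\<forall>\<^sub>F x in at_infinity. - norm p + norm x \<le> norm (p - x)" by simp
  qed
  then show "((\<lambda>x. 2 * r / norm (p - x)) \<longlongrightarrow> 0) at_infinity"
    by (intro tendsto_divide_0[OF tendsto_const] filterlim_at_top_imp_at_infinity)
qed auto

lemma gaussian_in_C0: "0 < r \<Longrightarrow> gaussian p r \<in> C0_functions"
  by (simp add: C0_functions_def continuous_on_gaussian tendsto_gaussian_at_infinity)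

lemma sum_in_C0:
  "(\<And>i. i \<in> I \<Longrightarrow> f i \<in> C0_functions) \<Longrightarrow> (\<lambda>x. \<Sum>i\<in>I. f i x) \<in> C0_functions"
  unfolding C0_functions_def by (auto intro!: continuous_on_sum tendsto_null_sum)

lemma gauss_sum_eq: "gauss_sum P = (\<lambda>x. \<Sum>q\<in>P. gaussian (fst q) (snd q) x)"
  by (simp add: gauss_sum_def case_prod_beta fun_eq_iff)

lemma gauss_sum_in_C0:
  assumes "P \<subseteq> K \<times> {0<..}"
  shows "gauss_sum P \<in> C0_functions"
  unfolding gauss_sum_eq using assms by (intro sum_in_C0 gaussian_in_C0) auto

lemma gauss_sum_Lipschitz:
  fixes P :: "('a::real_normed_vector \<times> real) set"
  assumes "P \<subseteq> K \<times> {0<..}"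
  shows "\<exists>L\<ge>0. \<forall>x y. \<bar>gauss_sum P x - gauss_sum P y\<bar> \<le> L * norm (x - y)"
proof (intro exI[of _ "\<Sum>q\<in>P. 2 / snd q"] conjI allI)
  show "0 \<le> (\<Sum>q\<in>P. 2 / snd q)" using assms by (intro sum_nonneg) force
  fix x y
  have "\<bar>gauss_sum P x - gauss_sum P y\<bar> \<le>
      (\<Sum>q\<in>P. \<bar>gaussian (fst q) (snd q) x - gaussian (fst q) (snd q) y\<bar>)"
    unfolding gauss_sum_eq sum_subtractf[symmetric] by (rule sum_abs)
  also have "\<dots> \<le> (\<Sum>q\<in>P. 2 / snd q * norm (x - y))"
  proof (rule sum_mono)
    fix q assume "q \<in> P"
    then have r: "0 < snd q" using assms by auto
    have "\<bar>gaussian (fst q) (snd q) x - gaussian (fst q) (snd q) y\<bar> \<le> norm (x - y) / snd q *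
      (exp (- ((norm (fst q - x) / snd q)\<^sup>2 / 8)) + exp (- ((norm (fst q - y) / snd q)\<^sup>2 / 8)))"
      by (rule gaussian_diff_le[OF r])
    also have "\<dots> \<le> norm (x - y) / snd q * (1 + 1)"
      using r by (intro mult_left_mono add_mono) auto
    finally show "\<bar>gaussian (fst q) (snd q) x - gaussian (fst q) (snd q) y\<bar>
        \<le> 2 / snd q * norm (x - y)"
      by (simp add: mult.commute)
  qed
  finally show "\<bar>gauss_sum P x - gauss_sum P y\<bar> \<le> (\<Sum>q\<in>P. 2 / snd q) * norm (x - y)"
    by (simp add: sum_distrib_right)
qed

text \<open>
  The maximum of \<open>u powr b * exp (- u)\<close> is attained at \<open>u = b\<close>; this is \<open>ln (u / b) \<le> u / b - 1\<close>.
\<close>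

lemma powr_mult_exp_neg_le:
  fixes u b :: real
  assumes "0 < u" "0 < b"
  shows "u powr b * exp (- u) \<le> b powr b"
proof -
  have "ln (u / b) \<le> u / b - 1" using assms by (intro ln_le_minus_one) auto
  then have "b * ln u \<le> u + b * ln b"
    using assms by (simp add: ln_div field_simps)
  then have "exp (b * ln u) \<le> exp (b * ln b) * exp u"
    by (simp add: exp_add[symmetric])
  then show ?thesis
    using assms by (simp add: powr_def exp_minus field_simps)
qed

lemma gaussian_le_powr:
  fixes p :: "'a::real_normed_vector"
  assumes r: "0 < r" and \<beta>: "0 < \<beta>" and \<delta>: "0 < \<delta>" "\<delta> \<le> norm (p - x)"
  shows "gaussian p r x \<le> (\<beta> / 2) powr (\<beta> / 2) * (2 / \<delta>) powr \<beta> * r powr \<beta>"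
proof -
  define v where "v = \<delta> / (2 * r)"
  have v: "0 < v" using r \<delta> by (simp add: v_def)
  have "v \<le> norm (p - x) / (2 * r)" unfolding v_def using \<delta> r by (intro divide_right_mono) auto
  then have "v\<^sup>2 \<le> (norm (p - x) / (2 * r))\<^sup>2" using v by (intro power_mono) auto
  then have "gaussian p r x \<le> exp (- v\<^sup>2)"
    by (simp add: gaussian_def power_divide power_mult_distrib)
  also have "\<dots> \<le> (\<beta> / 2) powr (\<beta> / 2) / (v\<^sup>2) powr (\<beta> / 2)"
    using powr_mult_exp_neg_le[of "v\<^sup>2" "\<beta> / 2"] v \<beta> by (simp add: field_simps)
  also have "(v\<^sup>2) powr (\<beta> / 2) = v powr \<beta>"
    using v by (simp add: powr_powr flip: powr_numeral)
  also have "(\<beta> / 2) powr (\<beta> / 2) / v powr \<beta> = (\<beta> / 2) powr (\<beta> / 2) * (2 / \<delta>) powr \<beta> * r powr \<beta>"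
    using \<delta> r by (simp add: v_def powr_divide powr_mult)
  finally show ?thesis .
qed

text \<open>
  Away from its centres, a Gaussian sum is bounded by its \<open>\<beta>\<close>-dimensional cost, because a Gaussian
  decays faster than the power \<open>\<beta>\<close> of the distance.
\<close>

lemma gauss_sum_le_cost:
  fixes P :: "('a::real_normed_vector \<times> real) set"
  assumes P: "P \<subseteq> K \<times> {0<..}" and \<beta>: "0 < \<beta>"
    and \<delta>: "0 < \<delta>" "\<And>p. p \<in> K \<Longrightarrow> \<delta> \<le> norm (p - x)"
  shows "gauss_sum P x \<le> (\<beta> / 2) powr (\<beta> / 2) * (2 / \<delta>) powr \<beta> * (\<Sum>(p, r)\<in>P. r powr \<beta>)"
proof -
  have "gauss_sum P x \<le> (\<Sum>(p, r)\<in>P. (\<beta> / 2) powr (\<beta> / 2) * (2 / \<delta>) powr \<beta> * r powr \<beta>)"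
    unfolding gauss_sum_def using P \<beta> \<delta>
    by (intro sum_mono) (auto intro!: gaussian_le_powr)
  then show ?thesis by (simp add: sum_distrib_left case_prod_beta)
qed

section \<open>Atoms tested against Gaussians\<close>

lemma compl_signed_support:
  "- signed_support mu = \<Union>{U. open U \<and> emeasure (total_variation mu) U = 0}"
  by (auto simp: signed_support_def zero_less_iff_neq_zero)

text \<open>
  By Lindelof's theorem the union of all open null sets is a union of countably many of them.
\<close>

lemma emeasure_total_variation_compl_support:
  fixes mu :: "'a::second_countable_topology set \<Rightarrow> real"
  shows "emeasure (total_variation mu) (- signed_support mu) = 0"
proof -
  define \<U> where "\<U> = {U. open U \<and> emeasure (total_variation mu) U = 0}"
  have "- signed_support mu = \<Union>\<U>"
    unfolding \<U>_def by (rule compl_signed_support)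
  moreover obtain \<V> where \<V>: "\<V> \<subseteq> \<U>" "countable \<V>" "\<Union>\<V> = \<Union>\<U>"
    using Lindelof[of \<U>] by (auto simp: \<U>_def)
  have "(\<Union>U\<in>\<V>. U) \<in> null_sets (total_variation mu)"
    using \<V> by (intro null_sets_UN') (auto simp: \<U>_def null_sets_def)
  ultimately show ?thesis using \<V>(3) by (simp add: null_sets_def)
qed

lemma integral_close_to_const:
  fixes F :: "'a \<Rightarrow> real"
  assumes "finite_measure M" and F: "integrable M F" and e: "AE x in M. \<bar>F x - v\<bar> \<le> e"
  shows "\<bar>(LINT x|M. F x) - v * measure M (space M)\<bar> \<le> e * measure M (space M)"
proof -
  interpret finite_measure M by fact
  have "(LINT x|M. F x) - v * measure M (space M) = (LINT x|M. F x - v)"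
    using F by simp
  also have "\<bar>\<dots>\<bar> \<le> (LINT x|M. \<bar>F x - v\<bar>)"
    using integral_norm_bound[of M "\<lambda>x. F x - v"] by simp
  also have "\<dots> \<le> (LINT x|M. e)"
    using F e by (intro integral_mono_AE) auto
  finally show ?thesis by (simp add: mult.commute)
qed

text \<open>
  The variation measures of \<open>a\<close> live on \<open>Q\<close>, and if \<open>a Q = 0\<close> they have the same mass, so the
  constant \<open>v\<close> may be subtracted from \<open>F\<close> in both integrals. With \<open>v = 0\<close> this is the trivial
  bound by the supremum of \<open>F\<close>; with \<open>v\<close> a value of \<open>F\<close> it is the gain from cancellation.
\<close>

lemma signed_integral_le_oscillation:
  fixes a :: "'a::second_countable_topology set \<Rightarrow> real"
  assumes a: "finite_signed_measure a" and tv: "emeasure (total_variation a) UNIV \<le> 1"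
    and supp: "signed_support a \<subseteq> Q" and Q: "Q \<in> sets borel"
    and F: "continuous_on UNIV F" "\<And>x. \<bar>F x\<bar> \<le> B"
    and v: "v = 0 \<or> a Q = 0" and e: "\<And>x. x \<in> Q \<Longrightarrow> \<bar>F x - v\<bar> \<le> e" "0 \<le> e"
  shows "\<bar>signed_integral a F\<bar> \<le> e"
proof -
  let ?U = "upper_variation a" and ?L = "lower_variation a"
  interpret U: finite_measure ?U by (rule finite_measure_upper_variation[OF a])
  interpret L: finite_measure ?L by (rule finite_measure_lower_variation[OF a])
  have "emeasure (total_variation a) (- Q) \<le> emeasure (total_variation a) (- signed_support a)"
  proof (rule emeasure_mono)
    show "- signed_support a \<in> sets (total_variation a)"
      unfolding compl_signed_support by (auto intro!: borel_open)
  qed (use supp in auto)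
  then have "emeasure ?U (- Q) + emeasure ?L (- Q) = 0"
    using emeasure_total_variation[of "- Q" a] Q
    by (simp add: emeasure_total_variation_compl_support)
  then have null: "- Q \<in> null_sets ?U" "- Q \<in> null_sets ?L"
    using Q by (auto simp: null_sets_def)
  have AE: "AE x in ?U. \<bar>F x - v\<bar> \<le> e" "AE x in ?L. \<bar>F x - v\<bar> \<le> e"
    using null e(1) by (auto intro!: AE_I'[of "- Q"])
  have "ennreal (measure ?U UNIV + measure ?L UNIV) \<le> 1"
    using tv by (simp add: emeasure_total_variation U.emeasure_eq_measure L.emeasure_eq_measure)
  then have mass: "measure ?U UNIV + measure ?L UNIV \<le> 1"
    by (simp only: ennreal_le_1)
  have "measure ?U UNIV = measure ?U Q" "measure ?L UNIV = measure ?L Q"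
    using null Q by (auto intro!: measure_eq_AE AE_I'[of "- Q"])
  then have "v * measure ?U UNIV = v * measure ?L UNIV"
    using v signed_measure_Jordan[OF a Q] by auto
  moreover have "\<bar>(LINT x|?U. F x) - v * measure ?U UNIV\<bar> \<le> e * measure ?U UNIV"
    using integral_close_to_const[OF U.finite_measure_axioms _ AE(1)]
      integrable_bounded_continuous[OF U.finite_measure_axioms _ F] by simp
  moreover have "\<bar>(LINT x|?L. F x) - v * measure ?L UNIV\<bar> \<le> e * measure ?L UNIV"
    using integral_close_to_const[OF L.finite_measure_axioms _ AE(2)]
      integrable_bounded_continuous[OF L.finite_measure_axioms _ F] by simp
  ultimately have "\<bar>signed_integral a F\<bar> \<le> e * (measure ?U UNIV + measure ?L UNIV)"
    unfolding signed_integral_def distrib_left by linarith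
  also have "\<dots> \<le> e * 1" using mass e(2) by (intro mult_left_mono)
  finally show ?thesis by simp
qed

text \<open>
  Up to normalisation, integrating a Gaussian of width \<open>r\<close> against \<open>a\<close> is evaluating the heat
  extension of \<open>a\<close> at time \<open>r\<^sup>2\<close>. Hence the size condition on atoms is a bound on integrals of
  Gaussians.
\<close>

lemma heat_semigroup_eq_gaussian:
  assumes r: "0 < r"
  shows "heat_semigroup (r\<^sup>2) a p =
    (4 * pi * r\<^sup>2) powr (- (real CARD('n) / 2)) * signed_integral a (gaussian (p :: real ^ 'n) r)"
  by (simp add: heat_semigroup_def signed_integral_def gaussian_def right_diff_distrib)

text \<open>
  The only properties of an atom with cube of side \<open>l\<close> that are used: Gaussians of width much smaller
  than \<open>l\<close> have a small integral by the heat semigroup bound, functions that vary slowly at scale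
  \<open>l\<close> have a small integral by cancellation, and bounded functions have a bounded integral.
\<close>

lemma beta_atom_estimates:
  fixes a :: "(real ^ 'n) set \<Rightarrow> real"
  assumes "beta_atom \<beta> a"
  shows "\<exists>l>0. (\<forall>p. \<forall>r>0. \<bar>signed_integral a (gaussian p r)\<bar>
        \<le> (4 * pi) powr (real CARD('n) / 2) * r powr \<beta> * l powr (- \<beta>)) \<and>
      (\<forall>F L B. continuous_on UNIV F \<longrightarrow> (\<forall>x. \<bar>F x\<bar> \<le> B) \<longrightarrow> 0 \<le> L \<longrightarrow>
        (\<forall>x y. \<bar>F x - F y\<bar> \<le> L * norm (x - y)) \<longrightarrow>
        \<bar>signed_integral a F\<bar> \<le> L * real CARD('n) * l) \<and>
      (\<forall>F B. continuous_on UNIV F \<longrightarrow> (\<forall>x. \<bar>F x\<bar> \<le> B) \<longrightarrow> \<bar>signed_integral a F\<bar> \<le> B)"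
proof -
  let ?d = "real CARD('n)"
  obtain c l where l: "0 < l" and a: "finite_signed_measure a"
      "signed_support a \<subseteq> cbox c (c + (\<chi> i. l))" "a (cbox c (c + (\<chi> i. l))) = 0"
      "\<And>x t. 0 < t \<Longrightarrow> \<bar>t powr ((?d - \<beta>) / 2) * heat_semigroup t a x\<bar> \<le> l powr (- \<beta>)"
      "emeasure (total_variation a) UNIV \<le> 1"
    using assms unfolding beta_atom_def Let_def by blast
  have "\<bar>signed_integral a (gaussian p r)\<bar> \<le> (4 * pi) powr (?d / 2) * r powr \<beta> * l powr (- \<beta>)"
    if r: "0 < r" for p r
  proof -
    define I where "I = signed_integral a (gaussian p r)"
    have "(r\<^sup>2) powr ((?d - \<beta>) / 2) * heat_semigroup (r\<^sup>2) a p
        = (4 * pi) powr (- (?d / 2)) * r powr (- \<beta>) * I"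
    proof -
      have pw: "(r\<^sup>2) powr (s / 2) = r powr s" for s
        using r by (simp add: powr_powr flip: powr_numeral)
      have "(4 * pi * r\<^sup>2) powr (- (?d / 2)) = (4 * pi) powr (- (?d / 2)) * (r\<^sup>2) powr (- ?d / 2)"
        by (simp add: powr_mult)
      then have "(r\<^sup>2) powr ((?d - \<beta>) / 2) * heat_semigroup (r\<^sup>2) a p
          = (4 * pi) powr (- (?d / 2)) * (r powr (?d - \<beta>) * r powr (- ?d)) * I"
        unfolding heat_semigroup_eq_gaussian[OF r] I_def[symmetric] pw by (simp only: ac_simps)
      also have "r powr (?d - \<beta>) * r powr (- ?d) = r powr (- \<beta>)"
        by (simp add: powr_add[symmetric])
      finally show ?thesis .
    qed
    then have "(4 * pi) powr (- (?d / 2)) * r powr (- \<beta>) * \<bar>I\<bar> \<le> l powr (- \<beta>)"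
      using a(4)[of "r\<^sup>2" p] r by (simp add: abs_mult)
    then have "(4 * pi) powr (?d / 2) * r powr \<beta> * ((4 * pi) powr (- (?d / 2)) * r powr (- \<beta>) * \<bar>I\<bar>)
        \<le> (4 * pi) powr (?d / 2) * r powr \<beta> * l powr (- \<beta>)"
      by (intro mult_left_mono) auto
    moreover have "(4 * pi) powr (?d / 2) * r powr \<beta> *
        ((4 * pi) powr (- (?d / 2)) * r powr (- \<beta>) * \<bar>I\<bar>) = \<bar>I\<bar>"
      using r by (simp add: powr_minus field_simps)
    ultimately show ?thesis unfolding I_def by (simp only:)
  qed
  moreover have "\<bar>signed_integral a F\<bar> \<le> L * ?d * l"
    if F: "continuous_on UNIV F" "\<forall>x. \<bar>F x\<bar> \<le> B" "0 \<le> L"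
      "\<forall>x y. \<bar>F x - F y\<bar> \<le> L * norm (x - y)" for F L B
  proof (rule signed_integral_le_oscillation[OF a(1,5,2) _ F(1), of B "F c"])
    fix x assume x: "x \<in> cbox c (c + (\<chi> i. l))"
    have "norm (x - c) \<le> (\<Sum>i\<in>UNIV. \<bar>(x - c) $ i\<bar>)" by (rule norm_le_l1_cart)
    also have "\<dots> \<le> (\<Sum>i\<in>(UNIV :: 'n set). l)"
      using x by (intro sum_mono) (auto simp: mem_box_cart abs_le_iff diff_le_eq add.commute)
    finally have "norm (x - c) \<le> ?d * l" by simp
    then have "L * norm (x - c) \<le> L * (?d * l)" using F(3) by (rule mult_left_mono)
    then show "\<bar>F x - F c\<bar> \<le> L * ?d * l" using F(4) by (smt (verit) mult.assoc)
  qed (use F a(3) l in auto)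
  moreover have "\<bar>signed_integral a F\<bar> \<le> B"
    if F: "continuous_on UNIV F" "\<forall>x. \<bar>F x\<bar> \<le> B" for F B
  proof -
    have "0 \<le> B" using F(2) by (meson abs_ge_zero order_trans)
    then show ?thesis
      using F by (intro signed_integral_le_oscillation[OF a(1,5,2) _ F(1), of B 0 B]) auto
  qed
  ultimately show ?thesis using l by blast
qed

text \<open>
  By duality, a uniform bound on the integrals of a test function against all atoms passes to the
  weak-star limits of combinations of atoms with bounded coefficient sums.
\<close>

lemma DS_pairing_bound:
  fixes mu :: "(real ^ 'n) set \<Rightarrow> real"
  assumes "mu \<in> DS \<beta>"
  shows "\<exists>\<Lambda>. \<forall>\<phi>\<in>C0_functions. \<forall>M\<ge>0.
    (\<forall>a. beta_atom \<beta> a \<longrightarrow> \<bar>signed_integral a \<phi>\<bar> \<le> M) \<longrightarrow> \<bar>signed_integral mu \<phi>\<bar> \<le> \<Lambda> * M"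
proof -
  obtain c a where atom: "\<And>n i. i \<in> {1..n} \<Longrightarrow> beta_atom \<beta> (a i n)"
    and ls: "limsup (\<lambda>n. ereal (\<Sum>i=1..n. \<bar>c i n\<bar>)) < \<infinity>"
    and lim: "\<And>\<phi>. \<phi> \<in> C0_functions \<Longrightarrow>
      (\<lambda>n. \<Sum>i=1..n. c i n * signed_integral (a i n) \<phi>) \<longlonglongrightarrow> signed_integral mu \<phi>"
    using assms unfolding DS_def by blast
  obtain N :: nat where "limsup (\<lambda>n. ereal (\<Sum>i=1..n. \<bar>c i n\<bar>)) < ereal (real N)"
    using ls less_PInf_Ex_of_nat by auto
  then have ev: "eventually (\<lambda>n. (\<Sum>i=1..n. \<bar>c i n\<bar>) < real N) sequentially"
    by (auto dest!: Limsup_lessD)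
  show ?thesis
  proof (intro exI[of _ "real N"] ballI allI impI)
    fix \<phi> :: "real ^ 'n \<Rightarrow> real" and M :: real assume \<phi>: "\<phi> \<in> C0_functions" and M: "0 \<le> M"
      and le: "\<forall>a. beta_atom \<beta> a \<longrightarrow> \<bar>signed_integral a \<phi>\<bar> \<le> M"
    have "eventually (\<lambda>n. \<bar>\<Sum>i=1..n. c i n * signed_integral (a i n) \<phi>\<bar> \<le> real N * M) sequentially"
      using ev
    proof eventually_elim
      case (elim n)
      have "\<bar>\<Sum>i=1..n. c i n * signed_integral (a i n) \<phi>\<bar>
          \<le> (\<Sum>i=1..n. \<bar>c i n * signed_integral (a i n) \<phi>\<bar>)" by (rule sum_abs)
      also have "\<dots> \<le> (\<Sum>i=1..n. \<bar>c i n\<bar> * M)"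
        using atom le by (intro sum_mono) (auto simp: abs_mult intro!: mult_left_mono)
      also have "\<dots> = (\<Sum>i=1..n. \<bar>c i n\<bar>) * M" by (simp add: sum_distrib_right)
      also have "\<dots> \<le> real N * M" using elim M by (intro mult_right_mono) auto
      finally show ?case .
    qed
    then show "\<bar>signed_integral mu \<phi>\<bar> \<le> real N * M"
      using tendsto_rabs[OF lim[OF \<phi>]] by (intro tendsto_upperbound) auto
  qed
qed

section \<open>Potentials with separated resonance scales\<close>

lemma hausdorff_measure_mono: "A \<subseteq> B \<Longrightarrow> hausdorff_measure s A \<le> hausdorff_measure s B"
  unfolding hausdorff_measure_def hausdorff_premeasure_def
  by (intro SUP_mono' INF_superset_mono) auto

lemma abs_gauss_sum_le:
  assumes "\<And>x. gauss_sum P x \<le> B" shows "\<bar>gauss_sum P x\<bar> \<le> B"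
  using assms[of x] by simp

lemma beta_atom_gauss_sum_le:
  fixes a :: "(real ^ 'n) set \<Rightarrow> real"
  assumes a: "finite_signed_measure a" and P: "P \<subseteq> K \<times> {0<..}"
    and le: "\<And>p r. 0 < r \<Longrightarrow> \<bar>signed_integral a (gaussian p r)\<bar> \<le> A * r powr \<beta> * l powr (- \<beta>)"
  shows "\<bar>signed_integral a (gauss_sum P)\<bar> \<le> A * (\<Sum>(p, r)\<in>P. r powr \<beta>) * l powr (- \<beta>)"
proof -
  have "signed_integral a (gauss_sum P) = (\<Sum>q\<in>P. signed_integral a (gaussian (fst q) (snd q)))"
    unfolding gauss_sum_eq
    by (intro signed_integral_sum[OF a, where C = "\<lambda>_. 1"]) (auto intro: continuous_on_gaussian)
  also have "\<bar>\<dots>\<bar> \<le> (\<Sum>q\<in>P. \<bar>signed_integral a (gaussian (fst q) (snd q))\<bar>)" by (rule sum_abs)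
  also have "\<dots> \<le> (\<Sum>q\<in>P. A * snd q powr \<beta> * l powr (- \<beta>))"
    using P by (intro sum_mono le) auto
  finally show ?thesis
    by (simp add: sum_distrib_left sum_distrib_right case_prod_beta)
qed

text \<open>
  Think of \<open>f n\<close> as the response of an atom of side \<open>l\<close> to the \<open>n\<close>-th test function. The scales
  \<open>s n\<close> decrease, and the two smallness conditions leave only indices with
  \<open>s n < l < s (n - 1)\<close>, or \<open>n = 0\<close> and \<open>s 0 < l\<close>, for which the bound \<open>B\<close> must be used; there is
  at most one such index.
\<close>

lemma sum_le_of_separated_resonances:
  fixes f :: "nat \<Rightarrow> real" and s :: "nat \<Rightarrow> real"
  assumes s: "\<And>n. s (Suc n) \<le> s n" and B: "0 \<le> B" and I: "finite I"
    and bounded: "\<And>n. f n \<le> B"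
    and small: "\<And>n. l \<le> s n \<Longrightarrow> f n \<le> (1 / 2) ^ n"
    and large: "\<And>n. s n \<le> l \<Longrightarrow> f (Suc n) \<le> (1 / 2) ^ Suc n"
  shows "(\<Sum>n\<in>I. f n) \<le> B + 2"
proof -
  define E where "E = {n\<in>I. (1 / 2) ^ n < f n}"
  have unique: "m = n" if mn: "m \<in> E" "n \<in> E" "m \<le> n" for m n
  proof (rule ccontr)
    assume "m \<noteq> n"
    with mn(3) obtain k where k: "n = Suc k" "m \<le> k" by (cases n) auto
    have "s m < l" using small[of m] mn(1) by (force simp: E_def)
    moreover have "l < s k" using large[of k] mn(2) k by (force simp: E_def)
    moreover have "s k \<le> s m" using lift_Suc_antimono_le[of s m k] s k by simp
    ultimately show False by simp
  qed
  have "finite E" using I by (simp add: E_def)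
  moreover have "\<forall>m\<in>E. \<forall>n\<in>E. m = n" using unique by (metis nat_le_linear)
  ultimately have "card E \<le> 1" by (simp add: card_le_Suc0_iff_eq)
  have "(\<Sum>n\<in>I. f n) \<le> (\<Sum>n\<in>I. (if n \<in> E then B else 0) + (1 / 2) ^ n)"
    by (intro sum_mono) (auto simp: E_def bounded add_increasing2 not_less)
  also have "\<dots> = real (card E) * B + (\<Sum>n\<in>I. (1 / 2) ^ n)"
    using I by (simp add: sum.distrib E_def flip: sum.inter_filter)
  also have "\<dots> \<le> 1 * B + (\<Sum>n. (1 / 2) ^ n)"
    using \<open>card E \<le> 1\<close> B I
    by (intro add_mono mult_right_mono sum_le_suminf) (auto intro: summable_geometric)
  also have "\<dots> = B + 2" by (simp add: suminf_geometric)
  finally show ?thesis .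
qed

text \<open>
  The potentials are chosen one after the other. Once \<open>P n\<close> is known, its Lipschitz constant
  determines a scale \<open>s n\<close> such that atoms of side at most \<open>s n\<close> do not see it, by cancellation. Then
  \<open>P (Suc n)\<close> is chosen of such small cost that atoms of side at least \<open>s n\<close> do not see it, by the
  heat semigroup bound. Each atom thus responds to at most one potential of the sequence, and the
  sum of its responses stays bounded however many potentials are added up.
\<close>

lemma asymptotically_invisible_potentials:
  fixes K :: "(real ^ 'n) set"
  assumes \<beta>: "0 < \<beta>" and B: "0 \<le> B"
    and potential: "\<And>\<eta>. 0 < \<eta> \<Longrightarrow> \<exists>P. finite P \<and> P \<subseteq> K \<times> {0<..} \<and> (\<forall>x. gauss_sum P x \<le> B) \<and>
      (\<forall>y\<in>K. exp (- (1 / 4)) \<le> gauss_sum P y) \<and> (\<Sum>(p, r)\<in>P. r powr \<beta>) \<le> \<eta>"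
  shows "\<exists>P. (\<forall>n. finite (P n) \<and> P n \<subseteq> K \<times> {0<..} \<and> (\<forall>x. gauss_sum (P n) x \<le> B) \<and>
      (\<forall>y\<in>K. exp (- (1 / 4)) \<le> gauss_sum (P n) y) \<and> (\<Sum>(p, r)\<in>P n. r powr \<beta>) \<le> (1 / 2) ^ n) \<and>
    (\<forall>a I. beta_atom \<beta> a \<longrightarrow> finite I \<longrightarrow>
      (\<Sum>n\<in>I. \<bar>signed_integral a (gauss_sum (P n))\<bar>) \<le> B + 2)"
proof -
  define A where "A = (4 * pi) powr (real CARD('n) / 2)"
  have A: "0 < A" by (simp add: A_def)
  define cost where "cost P = (\<Sum>(p, r)\<in>P. r powr \<beta>)" for P :: "((real ^ 'n) \<times> real) set"
  define good where "good P \<longleftrightarrow> finite P \<and> P \<subseteq> K \<times> {0<..} \<and> (\<forall>x. gauss_sum P x \<le> B) \<and>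
      (\<forall>y\<in>K. exp (- (1 / 4)) \<le> gauss_sum P y)" for P
  define resolved where "resolved n P s \<longleftrightarrow> 0 < s \<and> (\<exists>L\<ge>0.
      (\<forall>x y. \<bar>gauss_sum P x - gauss_sum P y\<bar> \<le> L * norm (x - y)) \<and>
      L * real CARD('n) * s \<le> (1 / 2) ^ n)" for n :: nat and P :: "((real ^ 'n) \<times> real) set" and s :: real
  have ex_resolved: "\<exists>s\<le>s0. resolved n P s" if P: "P \<subseteq> K \<times> {0<..}" and s0: "0 < s0" for n P s0
  proof -
    obtain L where L: "0 \<le> L" "\<And>x y. \<bar>gauss_sum P x - gauss_sum P y\<bar> \<le> L * norm (x - y)"
      using gauss_sum_Lipschitz[OF P] by blast
    define D where "D = L * real CARD('n)"
    have D: "0 \<le> D" using L by (simp add: D_def)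
    define s where "s = min s0 ((1 / 2) ^ n / (D + 1))"
    have "D * s \<le> (D + 1) * ((1 / 2) ^ n / (D + 1))"
      using D s0 by (intro mult_mono) (auto simp: s_def)
    also have "\<dots> = (1 / 2) ^ n" using D by simp
    finally have "D * s \<le> (1 / 2) ^ n" .
    moreover have "0 < s" "s \<le> s0" using s0 D by (auto simp: s_def)
    ultimately show ?thesis using L unfolding resolved_def D_def by blast
  qed
  have ex_good: "\<exists>P. good P \<and> cost P \<le> \<eta>" if "0 < \<eta>" for \<eta>
    using potential[OF that] unfolding good_def cost_def by blast
  have "\<exists>f. \<forall>n. (good (fst (f n)) \<and> cost (fst (f n)) \<le> (1 / 2) ^ n \<and> resolved n (fst (f n)) (snd (f n))) \<and>
      (snd (f (Suc n)) \<le> snd (f n) \<and>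
       A * cost (fst (f (Suc n))) * snd (f n) powr (- \<beta>) \<le> (1 / 2) ^ Suc n)"
  proof (rule dependent_nat_choice)
    obtain P where P: "good P" "cost P \<le> 1" using ex_good[of 1] by auto
    then obtain s where "resolved 0 P s" using ex_resolved[of P 1 0] by (auto simp: good_def)
    with P show "\<exists>f. good (fst f) \<and> cost (fst f) \<le> (1 / 2) ^ 0 \<and> resolved 0 (fst f) (snd f)"
      by (intro exI[of _ "(P, s)"]) simp
  next
    fix f :: "((real ^ 'n) \<times> real) set \<times> real" and n
    assume f: "good (fst f) \<and> cost (fst f) \<le> (1 / 2) ^ n \<and> resolved n (fst f) (snd f)"
    define s where "s = snd f"
    have s: "0 < s" using f by (simp add: resolved_def s_def)
    define t where "t = (1 / 2) ^ Suc n / (A * s powr (- \<beta>))"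
    have t: "0 < t" using A s by (simp add: t_def)
    obtain P where P: "good P" "cost P \<le> min ((1 / 2) ^ Suc n) t"
      using ex_good[of "min ((1 / 2) ^ Suc n) t"] t by auto
    have "cost P \<le> t" using P(2) by simp
    then have "A * cost P * s powr (- \<beta>) \<le> (1 / 2) ^ Suc n"
      using A s by (simp add: t_def field_simps)
    moreover obtain s' where "s' \<le> s" "resolved (Suc n) P s'"
      using ex_resolved[of P s "Suc n"] P(1) s by (auto simp: good_def)
    ultimately show "\<exists>g. (good (fst g) \<and> cost (fst g) \<le> (1 / 2) ^ Suc n \<and> resolved (Suc n) (fst g) (snd g)) \<and>
        (snd g \<le> snd f \<and> A * cost (fst g) * snd f powr (- \<beta>) \<le> (1 / 2) ^ Suc n)"
      using P by (intro exI[of _ "(P, s')"]) (simp add: s_def)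
  qed
  then obtain f where f: "\<And>n. good (fst (f n))" "\<And>n. cost (fst (f n)) \<le> (1 / 2) ^ n"
      "\<And>n. resolved n (fst (f n)) (snd (f n))" "\<And>n. snd (f (Suc n)) \<le> snd (f n)"
      "\<And>n. A * cost (fst (f (Suc n))) * snd (f n) powr (- \<beta>) \<le> (1 / 2) ^ Suc n"
    by blast
  define P where "P n = fst (f n)" for n
  define s where "s n = snd (f n)" for n
  have P: "finite (P n)" "P n \<subseteq> K \<times> {0<..}" "gauss_sum (P n) x \<le> B" for n x
    using f(1)[of n] by (auto simp: good_def P_def)
  have s: "0 < s n" for n using f(3)[of n] by (simp add: resolved_def s_def)
  have cont: "continuous_on UNIV (gauss_sum (P n))" for n
    using gauss_sum_in_C0[OF P(2)] by (simp add: C0_functions_def)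
  have "(\<Sum>n\<in>I. \<bar>signed_integral a (gauss_sum (P n))\<bar>) \<le> B + 2"
    if a: "beta_atom \<beta> a" and I: "finite I" for a I
  proof -
    have fsm: "finite_signed_measure a" using a by (simp add: beta_atom_def)
    obtain l where l: "0 < l"
      "\<And>p r. 0 < r \<Longrightarrow> \<bar>signed_integral a (gaussian p r)\<bar> \<le> A * r powr \<beta> * l powr (- \<beta>)"
      "\<And>F L B. continuous_on UNIV F \<Longrightarrow> (\<forall>x. \<bar>F x\<bar> \<le> B) \<Longrightarrow> 0 \<le> L \<Longrightarrow>
        (\<forall>x y. \<bar>F x - F y\<bar> \<le> L * norm (x - y)) \<Longrightarrow> \<bar>signed_integral a F\<bar> \<le> L * real CARD('n) * l"
      "\<And>F B. continuous_on UNIV F \<Longrightarrow> (\<forall>x. \<bar>F x\<bar> \<le> B) \<Longrightarrow> \<bar>signed_integral a F\<bar> \<le> B"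
      using beta_atom_estimates[OF a] unfolding A_def by blast
    have bd: "\<forall>x. \<bar>gauss_sum (P n) x\<bar> \<le> B" for n
      using P(3) by (simp add: abs_gauss_sum_le)
    show ?thesis
    proof (rule sum_le_of_separated_resonances[of s, OF _ B I])
      show "s (Suc n) \<le> s n" for n using f(4) by (simp add: s_def)
      show "\<bar>signed_integral a (gauss_sum (P n))\<bar> \<le> B" for n
        by (rule l(4)[OF cont bd])
      show "\<bar>signed_integral a (gauss_sum (P n))\<bar> \<le> (1 / 2) ^ n" if "l \<le> s n" for n
      proof -
        obtain L where L: "0 \<le> L"
            "\<forall>x y. \<bar>gauss_sum (P n) x - gauss_sum (P n) y\<bar> \<le> L * norm (x - y)"
            "L * real CARD('n) * s n \<le> (1 / 2) ^ n"
          using f(3)[of n] by (auto simp: resolved_def P_def s_def)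
        have "\<bar>signed_integral a (gauss_sum (P n))\<bar> \<le> L * real CARD('n) * l"
          by (rule l(3)[OF cont bd L(1,2)])
        also have "\<dots> \<le> L * real CARD('n) * s n" using that L(1) by (intro mult_left_mono) auto
        finally show ?thesis using L(3) by simp
      qed
      show "\<bar>signed_integral a (gauss_sum (P (Suc n)))\<bar> \<le> (1 / 2) ^ Suc n" if "s n \<le> l" for n
      proof -
        have "\<bar>signed_integral a (gauss_sum (P (Suc n)))\<bar> \<le> A * cost (P (Suc n)) * l powr (- \<beta>)"
          unfolding cost_def by (rule beta_atom_gauss_sum_le[OF fsm P(2) l(2)])
        also have "\<dots> \<le> A * cost (P (Suc n)) * s n powr (- \<beta>)"
        proof (rule mult_left_mono)
          show "l powr (- \<beta>) \<le> s n powr (- \<beta>)"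
            using that s[of n] \<beta> by (intro powr_mono2') auto
          show "0 \<le> A * cost (P (Suc n))"
            using A by (auto simp: cost_def intro!: mult_nonneg_nonneg sum_nonneg)
        qed
        also have "\<dots> \<le> (1 / 2) ^ Suc n" using f(5)[of n] by (simp add: P_def s_def)
        finally show ?thesis .
      qed
    qed
  qed
  moreover have "\<forall>n. finite (P n) \<and> P n \<subseteq> K \<times> {0<..} \<and> (\<forall>x. gauss_sum (P n) x \<le> B) \<and>
      (\<forall>y\<in>K. exp (- (1 / 4)) \<le> gauss_sum (P n) y) \<and> (\<Sum>(p, r)\<in>P n. r powr \<beta>) \<le> (1 / 2) ^ n"
    using f(1,2) unfolding good_def cost_def P_def by blast
  ultimately show ?thesis by blast
qed

section \<open>The dimension bound\<close>

text \<open>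
  By \<open>gauss_sum_le_cost\<close>, since a point outside a closed set has positive distance to it.
\<close>

lemma gauss_sum_tendsto_0_off:
  fixes P :: "nat \<Rightarrow> ('a::real_normed_vector \<times> real) set"
  assumes P: "\<And>n. P n \<subseteq> K \<times> {0<..}" and \<beta>: "0 < \<beta>" and K: "closed K" and x: "x \<notin> K"
    and cost: "\<And>n. (\<Sum>(p, r)\<in>P n. r powr \<beta>) \<le> (1 / 2) ^ n"
  shows "(\<lambda>n. gauss_sum (P n) x) \<longlonglongrightarrow> 0"
proof -
  obtain \<delta> where \<delta>: "0 < \<delta>" "ball x \<delta> \<subseteq> - K"
    using K x open_contains_ball[of "- K"] by auto
  have far: "\<delta> \<le> norm (p - x)" if "p \<in> K" for p
    using \<delta>(2) that by (force simp: dist_norm norm_minus_commute not_less[symmetric])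
  define c where "c = (\<beta> / 2) powr (\<beta> / 2) * (2 / \<delta>) powr \<beta>"
  have c: "0 \<le> c" by (simp add: c_def)
  show ?thesis
  proof (rule tendsto_sandwich[of "\<lambda>_. 0" _ _ "\<lambda>n. c * (1 / 2) ^ n"])
    have "gauss_sum (P n) x \<le> c * (1 / 2) ^ n" for n
    proof -
      have "gauss_sum (P n) x \<le> c * (\<Sum>(p, r)\<in>P n. r powr \<beta>)"
        unfolding c_def by (rule gauss_sum_le_cost[OF P \<beta> \<delta>(1) far])
      also have "\<dots> \<le> c * (1 / 2) ^ n" using cost c by (rule mult_left_mono)
      finally show ?thesis .
    qed
    then show "\<forall>\<^sub>F n in sequentially. gauss_sum (P n) x \<le> c * (1 / 2) ^ n" by simp
    have "(\<lambda>n. c * (1 / 2) ^ n) \<longlonglongrightarrow> c * 0"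
      by (intro tendsto_mult_left LIMSEQ_power_zero) auto
    then show "(\<lambda>n. c * (1 / 2) ^ n) \<longlonglongrightarrow> 0" by simp
  qed auto
qed

text \<open>
  An approximate substitute for a Hahn decomposition. If \<open>mu A\<close> almost attains the supremum \<open>u\<close> that
  defines the upper variation of \<open>E\<close>, then the upper variation of \<open>A\<close> is almost \<open>u\<close>, and the lower
  variation of \<open>A\<close>, being the difference, is almost zero. Inner regularity replaces \<open>A\<close> by a compact
  set.
\<close>

lemma compact_where_positive_part_dominates:
  fixes mu :: "'a::euclidean_space set \<Rightarrow> real"
  assumes mu: "finite_signed_measure mu" and E: "E \<in> sets borel"
    and pos: "emeasure (upper_variation mu) E \<noteq> 0" and s: "0 < s"
  shows "\<exists>K\<subseteq>E. compact K \<and> 0 < measure (upper_variation mu) K \<and>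
    measure (lower_variation mu) K < s * measure (upper_variation mu) K"
proof -
  let ?U = "upper_variation mu" and ?L = "lower_variation mu"
  interpret U: finite_measure ?U by (rule finite_measure_upper_variation[OF mu])
  interpret L: finite_measure ?L by (rule finite_measure_lower_variation[OF mu])
  define u where "u = measure ?U E"
  have u: "0 < u" using pos by (simp add: u_def U.emeasure_eq_measure zero_less_measure_iff)
  define t where "t = min (1 / 2) (s / 2)"
  have t: "0 < t" "t \<le> 1 / 2" "t \<le> s / 2" using s by (auto simp: t_def)
  have "\<exists>A\<in>sets borel. A \<subseteq> E \<and> (1 - t) * u < mu A"
  proof (rule ccontr)
    assume "\<not> ?thesis"
    then have "u \<le> (1 - t) * u"
      unfolding u_def[symmetric] by (subst u_def, intro upper_variation_least[OF mu E]) (auto simp: not_less)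
    then show False using u t by (simp add: algebra_simps mult_le_0_iff)
  qed
  then obtain A where A: "A \<in> sets borel" "A \<subseteq> E" "(1 - t) * u < mu A" by blast
  have "measure ?U A \<le> u" unfolding u_def using A E by (intro U.finite_measure_mono) auto
  then have LA: "measure ?L A < t * u"
    using A(3) signed_measure_Jordan[OF mu A(1)] by (simp add: left_diff_distrib)
  have UA: "(1 - t) * u < measure ?U A"
    using A(3) signed_measure_Jordan[OF mu A(1)] measure_nonneg[of ?L A] by linarith
  have "ennreal ((1 - t) * u) < emeasure ?U A"
    using UA u t by (simp add: U.emeasure_eq_measure ennreal_less_iff)
  also have "emeasure ?U A = (SUP K \<in> {K. K \<subseteq> A \<and> compact K}. emeasure ?U K)"
    using A by (intro inner_regular U.emeasure_finite) auto
  finally obtain K where K: "K \<subseteq> A" "compact K" "ennreal ((1 - t) * u) < emeasure ?U K"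
    by (auto simp: less_SUP_iff)
  have UK: "(1 - t) * u < measure ?U K"
    using K(3) u t by (simp add: U.emeasure_eq_measure ennreal_less_iff)
  have "measure ?L K \<le> measure ?L A" using K A by (intro L.finite_measure_mono) auto
  also note LA
  also have "t * u \<le> s * ((1 - t) * u)"
  proof -
    have "s * (1 / 2) \<le> s * (1 - t)" using s t by (intro mult_left_mono) auto
    then have "t \<le> s * (1 - t)" using t(3) by linarith
    then have "t * u \<le> (s * (1 - t)) * u" using u by (intro mult_right_mono) auto
    then show ?thesis by (simp add: mult.assoc)
  qed
  also have "\<dots> < s * measure ?U K" using UK s by simp
  finally have "measure ?L K < s * measure ?U K" .
  moreover have "0 < measure ?U K"
  proof -
    have "0 \<le> (1 - t) * u" using t u by simp
    with UK show ?thesis by linarith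
  qed
  ultimately show ?thesis using K A by blast
qed

text \<open>
  The positive part contributes at least \<open>c\<close> times its mass on \<open>K\<close>, the negative part at most \<open>B\<close>
  times its mass on \<open>K\<close> plus an integral over the complement of \<open>K\<close>, which tends to zero by dominated
  convergence.
\<close>

lemma eventually_signed_integral_ge:
  fixes F :: "nat \<Rightarrow> 'a::euclidean_space \<Rightarrow> real"
  assumes mu: "finite_signed_measure mu" and K: "K \<in> sets borel"
    and cont: "\<And>n. continuous_on UNIV (F n)" and F: "\<And>n x. 0 \<le> F n x" "\<And>n x. F n x \<le> B"
    and lower: "\<And>n y. y \<in> K \<Longrightarrow> c \<le> F n y" and off: "\<And>x. x \<notin> K \<Longrightarrow> (\<lambda>n. F n x) \<longlonglongrightarrow> 0"
    and \<kappa>: "\<kappa> < c * measure (upper_variation mu) K - B * measure (lower_variation mu) K"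
  shows "eventually (\<lambda>n. \<kappa> < signed_integral mu (F n)) sequentially"
proof -
  let ?U = "upper_variation mu" and ?L = "lower_variation mu"
  interpret U: finite_measure ?U by (rule finite_measure_upper_variation[OF mu])
  interpret L: finite_measure ?L by (rule finite_measure_lower_variation[OF mu])
  have abs: "\<bar>F n x\<bar> \<le> B" for n x using F[of n x] by simp
  have int: "integrable ?U (F n)" "integrable ?L (F n)" for n
    using integrable_bounded_continuous[OF U.finite_measure_axioms _ cont abs]
      integrable_bounded_continuous[OF L.finite_measure_axioms _ cont abs] by auto
  have meas: "F n \<in> borel_measurable ?L" for n using int(2) by auto
  define e where "e n = (LINT x|?L. indicator (- K) x * F n x)" for n
  have "e \<longlonglongrightarrow> (LINT x|?L. 0)"
    unfolding e_def
  proof (rule integral_dominated_convergence[where w = "\<lambda>_. B"])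
    show "AE x in ?L. (\<lambda>n. indicator (- K) x * F n x) \<longlonglongrightarrow> 0"
      using off by (auto simp: indicator_def)
    have B: "0 \<le> B" using F[of undefined undefined] by (rule order_trans)
    show "AE x in ?L. norm (indicator (- K) x * F n x) \<le> B" for n
      using abs B by (auto simp: indicator_def)
    show "(\<lambda>x. indicator (- K) x * F n x) \<in> borel_measurable ?L" for n
      using meas K by (intro borel_measurable_times borel_measurable_indicator) auto
  qed (use meas in auto)
  then have e: "e \<longlonglongrightarrow> 0" by simp
  have intK: "integrable ?L (\<lambda>x. B * indicator K x)" "integrable ?L (\<lambda>x. indicator (- K) x * F n x)" for n
    using K integrable_real_mult_indicator[of "- K" ?L "F n"] int(2)[of n]
    by (auto intro!: integrable_mult_right integrable_real_indicator
        simp: L.emeasure_eq_measure mult.commute)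
  have ge: "c * measure ?U K - B * measure ?L K - e n \<le> signed_integral mu (F n)" for n
  proof -
    have "(LINT x|?U. c * indicator K x) \<le> (LINT x|?U. F n x)"
    proof (rule integral_mono[OF _ int(1)])
      show "integrable ?U (\<lambda>x. c * indicator K x)"
        using K by (intro integrable_mult_right integrable_real_indicator)
          (auto simp: U.emeasure_eq_measure)
    qed (use F(1) lower in \<open>auto simp: indicator_def\<close>)
    moreover have "(LINT x|?L. F n x) \<le> (LINT x|?L. B * indicator K x + indicator (- K) x * F n x)"
      using F(2)
      by (intro integral_mono[OF int(2)] Bochner_Integration.integrable_add intK)
        (auto simp: indicator_def)
    moreover have "(LINT x|?L. B * indicator K x + indicator (- K) x * F n x) = B * measure ?L K + e n"
      unfolding e_def using K by (subst Bochner_Integration.integral_add[OF intK]) simp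
    ultimately show ?thesis
      using K by (simp add: signed_integral_def)
  qed
  have "eventually (\<lambda>n. e n < c * measure ?U K - B * measure ?L K - \<kappa>) sequentially"
    using e \<kappa> by (intro order_tendstoD(2)) auto
  then show ?thesis
  proof eventually_elim
    case (elim n)
    then show ?case using ge[of n] by linarith
  qed
qed

text \<open>
  On a suitable compact subset \<open>K\<close> of \<open>E\<close> the measure is essentially positive, so the potentials of
  \<open>asymptotically_invisible_potentials\<close> have integrals against \<open>mu\<close> that stay above some
  \<open>\<kappa> > 0\<close>. A sum of \<open>N\<close> of them has integral at least \<open>N * \<kappa>\<close>; but its integrals against all
  atoms, hence also against \<open>mu\<close>, are bounded independently of \<open>N\<close>.
\<close>

lemma upper_variation_null_of_hausdorff_null:
  fixes mu :: "(real ^ 'n) set \<Rightarrow> real"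
  assumes mu: "mu \<in> DS \<beta>" and ab: "0 < \<alpha>" "\<alpha> < \<beta>" "\<beta> \<le> 2 * \<alpha>"
    and E: "E \<in> sets borel" "hausdorff_measure \<alpha> E = 0"
  shows "emeasure (upper_variation mu) E = 0"
proof (rule ccontr)
  assume pos: "emeasure (upper_variation mu) E \<noteq> 0"
  have fsm: "finite_signed_measure mu" using mu by (simp add: DS_def)
  define c :: real where "c = exp (- (1 / 4))"
  have c: "0 < c" by (simp add: c_def)
  obtain B0 where B0: "\<And>(K :: (real ^ 'n) set) \<eta>. compact K \<Longrightarrow> hausdorff_measure \<alpha> K = 0 \<Longrightarrow> 0 < \<eta> \<Longrightarrow>
    (\<exists>P. finite P \<and> P \<subseteq> K \<times> {0<..} \<and> (\<forall>x. gauss_sum P x \<le> B0) \<and>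
      (\<forall>y\<in>K. exp (- (1 / 4)) \<le> gauss_sum P y) \<and> (\<Sum>(p, r)\<in>P. r powr \<beta>) \<le> \<eta>)"
    using gaussian_potential_of_null_set[OF ab, where 'a = "real ^ 'n"] by blast
  define B where "B = max 1 B0"
  have B: "1 \<le> B" "B0 \<le> B" "0 \<le> B" by (simp_all add: B_def)
  have \<beta>: "0 < \<beta>" using ab by simp
  obtain K where K: "K \<subseteq> E" "compact K" "0 < measure (upper_variation mu) K"
      "measure (lower_variation mu) K < c / B * measure (upper_variation mu) K"
    using compact_where_positive_part_dominates[OF fsm E(1) pos, of "c / B"] c B by auto
  define \<kappa> where "\<kappa> = (c * measure (upper_variation mu) K - B * measure (lower_variation mu) K) / 2"
  have "B * measure (lower_variation mu) K < c * measure (upper_variation mu) K"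
    using K(4) B by (simp add: field_simps)
  then have \<kappa>: "0 < \<kappa>" "\<kappa> < c * measure (upper_variation mu) K - B * measure (lower_variation mu) K"
    by (simp_all add: \<kappa>_def)
  have null: "hausdorff_measure \<alpha> K = 0"
    using hausdorff_measure_mono[OF K(1), of \<alpha>] E(2) by simp
  have "\<exists>P. finite P \<and> P \<subseteq> K \<times> {0<..} \<and> (\<forall>x. gauss_sum P x \<le> B) \<and>
      (\<forall>y\<in>K. exp (- (1 / 4)) \<le> gauss_sum P y) \<and> (\<Sum>(p, r)\<in>P. r powr \<beta>) \<le> \<eta>" if "0 < \<eta>" for \<eta>
    using B0[OF K(2) null that] B(2) by (meson order_trans)
  from asymptotically_invisible_potentials[OF \<beta> B(3) this]
  obtain P where P: "\<And>n. finite (P n)" "\<And>n. P n \<subseteq> K \<times> {0<..}" "\<And>n x. gauss_sum (P n) x \<le> B"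
      "\<And>n y. y \<in> K \<Longrightarrow> c \<le> gauss_sum (P n) y" "\<And>n. (\<Sum>(p, r)\<in>P n. r powr \<beta>) \<le> (1 / 2) ^ n"
    and inv: "\<And>a I. beta_atom \<beta> a \<Longrightarrow> finite I \<Longrightarrow>
      (\<Sum>n\<in>I. \<bar>signed_integral a (gauss_sum (P n))\<bar>) \<le> B + 2"
    unfolding c_def by blast
  have C0: "gauss_sum (P n) \<in> C0_functions" for n by (rule gauss_sum_in_C0[OF P(2)])
  have cont: "continuous_on UNIV (gauss_sum (P n))" for n using C0[of n] by (simp add: C0_functions_def)
  have abs: "\<bar>gauss_sum (P n) x\<bar> \<le> B" for n x using P(3) by (rule abs_gauss_sum_le)
  have "eventually (\<lambda>n. \<kappa> < signed_integral mu (gauss_sum (P n))) sequentially"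
  proof (rule eventually_signed_integral_ge[OF fsm _ cont _ P(3,4)])
    show "(\<lambda>n. gauss_sum (P n) x) \<longlonglongrightarrow> 0" if "x \<notin> K" for x
      using ab K(2) that by (intro gauss_sum_tendsto_0_off[OF P(2) _ _ _ P(5)]) (auto intro: compact_imp_closed)
  qed (use K \<kappa> in \<open>auto intro: borel_compact\<close>)
  then obtain n0 where n0: "\<And>n. n0 \<le> n \<Longrightarrow> \<kappa> < signed_integral mu (gauss_sum (P n))"
    by (auto simp: eventually_sequentially)
  obtain \<Lambda> where \<Lambda>: "\<And>\<phi> M. \<phi> \<in> C0_functions \<Longrightarrow> 0 \<le> M \<Longrightarrow>
      (\<And>a. beta_atom \<beta> a \<Longrightarrow> \<bar>signed_integral a \<phi>\<bar> \<le> M) \<Longrightarrow> \<bar>signed_integral mu \<phi>\<bar> \<le> \<Lambda> * M"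
    using DS_pairing_bound[OF mu] by blast
  obtain N :: nat where N: "\<Lambda> * (B + 2) < real N * \<kappa>"
    using reals_Archimedean3[OF \<kappa>(1)] by blast
  define I where "I = {n0..<n0 + N}"
  define G where "G = (\<lambda>x. \<Sum>n\<in>I. gauss_sum (P n) x)"
  have G: "signed_integral a G = (\<Sum>n\<in>I. signed_integral a (gauss_sum (P n)))"
    if "finite_signed_measure a" for a
    unfolding G_def by (rule signed_integral_sum[OF that cont abs])
  have "\<bar>signed_integral mu G\<bar> \<le> \<Lambda> * (B + 2)"
  proof (rule \<Lambda>)
    show "G \<in> C0_functions" unfolding G_def by (rule sum_in_C0[OF C0])
    fix a :: "(real ^ 'n) set \<Rightarrow> real" assume a: "beta_atom \<beta> a"
    then have "finite_signed_measure a" by (simp add: beta_atom_def)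
    then have "\<bar>signed_integral a G\<bar> \<le> (\<Sum>n\<in>I. \<bar>signed_integral a (gauss_sum (P n))\<bar>)"
      by (simp add: G sum_abs)
    also have "\<dots> \<le> B + 2" using a by (rule inv) (simp add: I_def)
    finally show "\<bar>signed_integral a G\<bar> \<le> B + 2" .
  qed (use B in simp)
  moreover have "real N * \<kappa> \<le> signed_integral mu G"
  proof -
    have "real N * \<kappa> = (\<Sum>n\<in>I. \<kappa>)" by (simp add: I_def)
    also have "\<dots> \<le> (\<Sum>n\<in>I. signed_integral mu (gauss_sum (P n)))"
      using n0 by (intro sum_mono less_imp_le) (simp add: I_def)
    finally show ?thesis by (simp add: G[OF fsm])
  qed
  ultimately show False using N by linarith
qed

lemma uminus_in_DS:
  assumes "mu \<in> DS \<beta>" shows "(\<lambda>A. - mu A) \<in> DS \<beta>"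
proof -
  obtain c a where "\<forall>n. \<forall>i\<in>{1..n}. beta_atom \<beta> (a i n)"
    and ls: "limsup (\<lambda>n. ereal (\<Sum>i=1..n. \<bar>c i n\<bar>)) < \<infinity>"
    and lim: "\<And>\<phi>. \<phi> \<in> C0_functions \<Longrightarrow>
      (\<lambda>n. \<Sum>i=1..n. c i n * signed_integral (a i n) \<phi>) \<longlonglongrightarrow> signed_integral mu \<phi>"
    using assms unfolding DS_def by blast
  moreover have "(\<lambda>n. \<Sum>i=1..n. - c i n * signed_integral (a i n) \<phi>)
      \<longlonglongrightarrow> signed_integral (\<lambda>A. - mu A) \<phi>" if "\<phi> \<in> C0_functions" for \<phi>
    using tendsto_minus[OF lim[OF that]] by (simp add: signed_integral_uminus sum_negf)
  moreover have "finite_signed_measure mu" using assms by (simp add: DS_def)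
  ultimately show ?thesis
    unfolding DS_def mem_Collect_eq
    by (intro conjI finite_signed_measure_uminus exI[of _ "\<lambda>i n. - c i n"] exI[of _ a]) auto
qed

theorem theorem8:
  fixes mu :: "(real ^ 'n) set \<Rightarrow> real" and \<beta> :: real
  assumes "0 < \<beta>" and "\<beta> \<le> real CARD('n)"
    and "mu \<in> DS \<beta>"
  shows "lower_hausdorff_dim mu \<ge> ennreal \<beta>"
proof -
  have le: "ennreal \<alpha> \<le> lower_hausdorff_dim mu" if \<alpha>: "\<beta> / 2 < \<alpha>" "\<alpha> < \<beta>" for \<alpha>
    unfolding lower_hausdorff_dim_def
  proof (rule SUP_upper, intro CollectI conjI ballI impI)
    fix E :: "(real ^ 'n) set" assume E: "E \<in> sets borel" "hausdorff_measure \<alpha> E = 0"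
    have "emeasure (upper_variation mu) E = 0"
      using \<alpha> assms E by (intro upper_variation_null_of_hausdorff_null[of mu \<beta> \<alpha>]) auto
    moreover have "emeasure (lower_variation mu) E = 0"
      unfolding lower_variation_def
      using \<alpha> assms E uminus_in_DS[OF assms(3)]
      by (intro upper_variation_null_of_hausdorff_null[of _ \<beta> \<alpha>]) auto
    ultimately show "emeasure (total_variation mu) E = 0"
      by (simp add: emeasure_total_variation[OF E(1)])
  qed (use \<alpha> assms in auto)
  show ?thesis
  proof (rule tendsto_upperbound)
    \<comment> \<open>only exponents strictly below \<open>\<beta>\<close> are available, and the supremum does not see the difference\<close>
    show "(ennreal \<longlongrightarrow> ennreal \<beta>) (at_left \<beta>)"
      by (intro tendsto_ennrealI tendsto_ident_at)
    have "eventually (\<lambda>\<alpha>. \<alpha> \<in> {\<beta> / 2<..<\<beta>}) (at_left \<beta>)"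
      using assms(1) by (intro eventually_at_left_real) auto
    then show "eventually (\<lambda>\<alpha>. ennreal \<alpha> \<le> lower_hausdorff_dim mu) (at_left \<beta>)"
      by eventually_elim (auto intro: le)
  qed simp
qed

end
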